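(* Let $\sigma\ge\tau\ge1$ be integers, $\sigma>1$. Suppose that the supports $[\underline c_k,\bar c_k]$ of the random coefficients $c_k$, $\tau\le k\le\sigma$, of a $(\tau,\sigma)$-polynomial cost function are known and nonnegative, with $\underline c_\tau>0$ and $\underline c_\sigma>0$, and let $\mathcal F$ be the class of $(\tau,\sigma)$-polynomial costs $f(y)=\sum_{k=\tau}^{\sigma}c_ky^k$ with $c_k\in[\underline c_k,\bar c_k]$. For each integer $d$ with $\tau\le d\le\sigma-1$, let $f^{(d)}$ be the $(\tau,\sigma)$-polynomial cost function with coefficients $\hat c_k=\underline c_k$ for $\tau\le k\le d$ and $\hat c_k=\bar c_k$ for $d<k\le\sigma$, and let $k^*$ denote the elasticity-based safe selection function induced by $\mathcal G=\{f^{(\tau)},f^{(\tau+1)},\dots,f^{(\sigma-1)}\}$. Then the cost function $\hat f$ built from $\mathcal G$ and $k^*$ (the safe envelope defined in the context) is strongly $(\tau,\sigma)$-elastic and satisfies that for any $\alpha\ge\alpha_\star^{(\sigma)}:=\sigma^{\sigma/(\sigma-1)}$, the $\alpha$-design space of $\hat f$, $\mathcal S(\alpha,\hat f)$, is an $\alpha$-universal design space for $\mathcal F$.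
   Context: A $(\tau,\sigma)$-polynomial is $f(y)=\sum_{k=\tau}^{\sigma}c_ky^k$ with $c_k\ge0$ and $c_\tau,c_\sigma>0$. OACC. There are $m\ge 1$ supply nodes with cost function $f$. An instance $I$ is a finite sequence $(\mathbf v_t,\mathbf w_t)_{t=1}^T$, $v_{t,j}\ge0$, $w_{t,j}>0$. When demand $t$ arrives, an irrevocable $\mathbf x_t\in\mathcal X=\{\mathbf x\in\mathbb{R}_+^m:\sum_jx_j\le1\}$ is chosen. The objective is $\sum_t\sum_jv_{t,j}x_{t,j}-\sum_jf(\sum_tw_{t,j}x_{t,j})$; an online algorithm is $\alpha$-competitive if $\mathrm{OPT}(I)\le\alpha\,\mathrm{ALG}(I)$ for all $I$, with $\mathrm{OPT}$ the offline maximum. PUMax-$\phi$: start with $y_{0,j}=0$; upon arrival of $t$ choose $\mathbf x_t\in\arg\max_{\mathbf x\in\mathcal X}\sum_jv_{t,j}x_j-\sum_j\int_{y_{t-1,j}}^{y_{t-1,j}+w_{t,j}x_j}f'(\phi(\eta))\,d\eta$, and set $y_{t,j}=y_{t-1,j}+w_{t,j}x_{t,j}$. A reserve function $\phi$ is $\alpha$-competitive for $f$ if PUMax-$\phi$ is $\alpha$-competitive for OACC with cost $f$. Elasticity: $Eg(y)=yg'(y)/g(y)$. A cost $f:\mathbb{R}_+\to\mathbb{R}_+$ is $(\tau,\sigma)$-elastic if it is increasing, smooth, strictly convex, analytic at the origin, $f(0)=f'(0)=0$, $Ef'$ is non-decreasing on $(0,\infty)$, and $\tau-1\le Ef'\le\sigma-1$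 on $(0,\infty)$; it is strongly $(\tau,\sigma)$-elastic if it moreover satisfies $\tau-2\le Ef''\le\sigma-2$ on $(0,\infty)$. Design space: $\mathcal S(\alpha,g)$ is the family of all $\phi:[0,\infty)\to[0,\infty)$ with $\phi'(y)=\alpha\frac{g'(\phi(y))-g'(y)}{\phi(y)g''(\phi(y))}$, $\phi'(y)\ge0$, $\phi(y)\ge y$ for all $y\ge0$ and $\phi(0)=0$; the same symbol denotes the planar region $\bigcup_\phi\{(y,\phi(y)):y\ge0\}$. $\mathcal S(\alpha,\hat f)$ is an $\alpha$-universal design space for $\mathcal F$ if it is contained in the design space (planar region) $\mathcal S(\alpha,f)$ of every $f\in\mathcal F$, and every $\alpha$-competitive design in $\mathcal S(\alpha,\hat f)$ is also $\alpha$-competitive for every $f\in\mathcal F$. Safe envelope of a finite family $\mathcal G=\{g_1,\dots,g_K\}$ of costs: the elasticity-based safe selection function is $k^*(y)=\arg\max_{k}Eg_k''(y)$ (smallest index), $y>0$; it is piecewise constant with switching points $y_1<y_2<\cdots$. Then $\hat f(y)=C(y)\,g_{k^*(y)}(y)+L(y)$, where $C$ is positive and piecewise constant and $L$ is piecewise linear (affine on each piece), both sharing the switching points of $k^*$, normalized by $C\equiv1$, $L\equiv0$ on the first piece $[0,y_1]$ and determined by requiring $\hat f,\hat f',\hat f''$ to agree at each switching point.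
   Formalization: For τ=1 the clause f̂'(0)=0 of strong elasticity is dropped, since f̂'(0)=c_1>0; "smooth" is read as C^3 because f̂ generally has no fourth derivative at switching points; for τ=σ the family 𝒢 is empty, f̂ is undefined and nothing is claimed. *)

theory Defs
  imports "HOL-Analysis.Analysis"
begin

section \<open>Costs on the half-line\<close>

text \<open>A cost is a function on \<open>[0,\<infinity>)\<close>, represented by a total function on the reals whose values
  at negative arguments are never used. All derivatives are therefore taken within \<open>{0..}\<close>: this is
  the ordinary derivative at positive points and the right derivative at \<open>0\<close>.\<close>

definition cost_deriv :: "(real \<Rightarrow> real) \<Rightarrow> real \<Rightarrow> real" where
  "cost_deriv f y = vector_derivative f (at y within {0..})"

definition elasticity :: "(real \<Rightarrow> real) \<Rightarrow> real \<Rightarrow> real" where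
  "elasticity g y = y * cost_deriv g y / g y"

text \<open>"Smooth" is read as three times continuously differentiable on \<open>[0,\<infinity>)\<close>, so that the
  elasticities of \<open>f'\<close> and \<open>f''\<close> are defined and continuous. Infinite differentiability is not what is
  meant: a safe envelope generally fails to have a fourth derivative at its switching points.\<close>

definition smooth_cost :: "(real \<Rightarrow> real) \<Rightarrow> bool" where
  "smooth_cost f \<longleftrightarrow>
     (\<forall>j<3. \<forall>y\<ge>0. ((cost_deriv ^^ j) f has_real_derivative (cost_deriv ^^ Suc j) f y)
                    (at y within {0..})) \<and>
     continuous_on {0..} ((cost_deriv ^^ 3) f)"

definition strictly_convex_on :: "real set \<Rightarrow> (real \<Rightarrow> real) \<Rightarrow> bool" where
  "strictly_convex_on S f \<longleftrightarrow> convex S \<and>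
     (\<forall>x\<in>S. \<forall>y\<in>S. \<forall>u. x \<noteq> y \<and> 0 < u \<and> u < 1 \<longrightarrow>
        f (u * x + (1 - u) * y) < u * f x + (1 - u) * f y)"

definition analytic_at_origin :: "(real \<Rightarrow> real) \<Rightarrow> bool" where
  "analytic_at_origin f \<longleftrightarrow>
     (\<exists>a :: nat \<Rightarrow> real. \<exists>r>0. \<forall>y\<in>{0..<r}. (\<lambda>n. a n * y ^ n) sums f y)"

text \<open>All requirements of elasticity except the normalization \<open>f'(0) = 0\<close>. The latter is kept
  separate because a polynomial with a positive linear coefficient cannot satisfy it.\<close>

definition elastic_up_to_slope :: "real \<Rightarrow> real \<Rightarrow> (real \<Rightarrow> real) \<Rightarrow> bool" where
  "elastic_up_to_slope \<tau> \<sigma> f \<longleftrightarrow>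
     (\<forall>y\<ge>0. f y \<ge> 0) \<and> strict_mono_on {0..} f \<and> smooth_cost f \<and> strictly_convex_on {0..} f \<and>
     analytic_at_origin f \<and> f 0 = 0 \<and>
     mono_on {0<..} (elasticity (cost_deriv f)) \<and>
     (\<forall>y>0. \<tau> - 1 \<le> elasticity (cost_deriv f) y \<and> elasticity (cost_deriv f) y \<le> \<sigma> - 1)"

definition elastic :: "real \<Rightarrow> real \<Rightarrow> (real \<Rightarrow> real) \<Rightarrow> bool" where
  "elastic \<tau> \<sigma> f \<longleftrightarrow> elastic_up_to_slope \<tau> \<sigma> f \<and> cost_deriv f 0 = 0"

definition second_elasticity_bounds :: "real \<Rightarrow> real \<Rightarrow> (real \<Rightarrow> real) \<Rightarrow> bool" where
  "second_elasticity_bounds \<tau> \<sigma> f \<longleftrightarrow>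
     (\<forall>y>0. \<tau> - 2 \<le> elasticity (cost_deriv (cost_deriv f)) y \<and>
            elasticity (cost_deriv (cost_deriv f)) y \<le> \<sigma> - 2)"

definition strongly_elastic :: "real \<Rightarrow> real \<Rightarrow> (real \<Rightarrow> real) \<Rightarrow> bool" where
  "strongly_elastic \<tau> \<sigma> f \<longleftrightarrow> elastic \<tau> \<sigma> f \<and> second_elasticity_bounds \<tau> \<sigma> f"

section \<open>Polynomial costs\<close>

definition poly_cost :: "nat \<Rightarrow> nat \<Rightarrow> (nat \<Rightarrow> real) \<Rightarrow> real \<Rightarrow> real" where
  "poly_cost \<tau> \<sigma> c y = (\<Sum>k=\<tau>..\<sigma>. c k * y ^ k)"

definition poly_coeffs :: "nat \<Rightarrow> nat \<Rightarrow> (nat \<Rightarrow> real) \<Rightarrow> bool" where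
  "poly_coeffs \<tau> \<sigma> c \<longleftrightarrow> (\<forall>k\<in>{\<tau>..\<sigma>}. c k \<ge> 0) \<and> c \<tau> > 0 \<and> c \<sigma> > 0"

definition poly_class ::
    "nat \<Rightarrow> nat \<Rightarrow> (nat \<Rightarrow> real) \<Rightarrow> (nat \<Rightarrow> real) \<Rightarrow> (real \<Rightarrow> real) set" where
  "poly_class \<tau> \<sigma> lo hi =
     {poly_cost \<tau> \<sigma> c | c. poly_coeffs \<tau> \<sigma> c \<and> (\<forall>k\<in>{\<tau>..\<sigma>}. lo k \<le> c k \<and> c k \<le> hi k)}"

definition threshold_cost ::
    "nat \<Rightarrow> nat \<Rightarrow> (nat \<Rightarrow> real) \<Rightarrow> (nat \<Rightarrow> real) \<Rightarrow> nat \<Rightarrow> real \<Rightarrow> real" where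
  "threshold_cost \<tau> \<sigma> lo hi d = poly_cost \<tau> \<sigma> (\<lambda>k. if k \<le> d then lo k else hi k)"

section \<open>Safe envelope\<close>

text \<open>A family of costs is given by a set \<open>J\<close> of indices and the costs \<open>g k\<close> for \<open>k \<in> J\<close>.\<close>

definition safe_selection :: "nat set \<Rightarrow> (nat \<Rightarrow> real \<Rightarrow> real) \<Rightarrow> real \<Rightarrow> nat" where
  "safe_selection J g y =
     (LEAST k. k \<in> J \<and>
        (\<forall>l\<in>J. elasticity (cost_deriv (cost_deriv (g l))) y
               \<le> elasticity (cost_deriv (cost_deriv (g k))) y))"

text \<open>An isolated point at which the smallest maximizing index differs from the one on both sides
  also counts as a switching point; the matching conditions make it harmless.\<close>

definition switching_points :: "nat set \<Rightarrow> (nat \<Rightarrow> real \<Rightarrow> real) \<Rightarrow> real set" where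
  "switching_points J g =
     {y. y > 0 \<and> \<not> (\<forall>\<^sub>F z in at y. safe_selection J g z = safe_selection J g y)}"

text \<open>The switching points are \<open>s 1 < \<dots> < s N\<close>, with \<open>s 0 = 0\<close>. Piece \<open>i \<le> N\<close> is
  \<open>[s i, s (i+1)]\<close>, and \<open>[s N, \<infinity>)\<close> for \<open>i = N\<close>. On it the selected index is \<open>\<kappa> i\<close>, the
  factor \<open>C\<close> is the constant \<open>C i\<close>, and \<open>L\<close> is \<open>y \<mapsto> a i * y + b i\<close>. The selection itself is only
  prescribed in the interior of a piece, the endpoints being covered by the matching conditions.\<close>

definition envelope_piece ::
    "(nat \<Rightarrow> real \<Rightarrow> real) \<Rightarrow> (nat \<Rightarrow> nat) \<Rightarrow> (nat \<Rightarrow> real) \<Rightarrow> (nat \<Rightarrow> real) \<Rightarrow> (nat \<Rightarrow> real)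
      \<Rightarrow> nat \<Rightarrow> real \<Rightarrow> real" where
  "envelope_piece g \<kappa> C a b i y = C i * g (\<kappa> i) y + (a i * y + b i)"

definition safe_envelope ::
    "nat set \<Rightarrow> (nat \<Rightarrow> real \<Rightarrow> real) \<Rightarrow> (real \<Rightarrow> real) \<Rightarrow> bool" where
  "safe_envelope J g fhat \<longleftrightarrow> finite J \<and> J \<noteq> {} \<and>
     (\<exists>(N::nat) s \<kappa> C a b.
        s 0 = 0 \<and> (\<forall>i<N. s i < s (Suc i)) \<and> s ` {1..N} = switching_points J g \<and>
        (\<forall>i\<le>N. \<forall>y. s i < y \<and> (i < N \<longrightarrow> y < s (Suc i)) \<longrightarrow> safe_selection J g y = \<kappa> i) \<and>
        (\<forall>i\<le>N. C i > 0) \<and> C 0 = 1 \<and> a 0 = 0 \<and> b 0 = 0 \<and>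
        (\<forall>i<N. \<forall>r\<le>2. (cost_deriv ^^ r) (envelope_piece g \<kappa> C a b i) (s (Suc i)) =
                       (cost_deriv ^^ r) (envelope_piece g \<kappa> C a b (Suc i)) (s (Suc i))) \<and>
        (\<forall>i\<le>N. \<forall>y. s i \<le> y \<and> (i < N \<longrightarrow> y \<le> s (Suc i)) \<longrightarrow>
             fhat y = envelope_piece g \<kappa> C a b i y))"

section \<open>Online allocation with convex costs\<close>

text \<open>Vectors in \<open>m\<close>-dimensional space are functions on the naturals, of which only the values below
  \<open>m\<close> matter. An instance consists of a length \<open>T\<close> and of \<open>v t j\<close> and \<open>w t j\<close> for \<open>t < T\<close>,
  \<open>j < m\<close>; arrivals are thus counted from \<open>0\<close>.\<close>

definition oacc_instance ::
    "nat \<Rightarrow> nat \<Rightarrow> (nat \<Rightarrow> nat \<Rightarrow> real) \<Rightarrow> (nat \<Rightarrow> nat \<Rightarrow> real) \<Rightarrow> bool" where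
  "oacc_instance m T v w \<longleftrightarrow> (\<forall>t<T. \<forall>j<m. v t j \<ge> 0 \<and> w t j > 0)"

definition decisions :: "nat \<Rightarrow> (nat \<Rightarrow> real) set" where
  "decisions m = {x. (\<forall>j<m. x j \<ge> 0) \<and> (\<Sum>j<m. x j) \<le> 1}"

definition oacc_objective ::
    "nat \<Rightarrow> (real \<Rightarrow> real) \<Rightarrow> nat \<Rightarrow> (nat \<Rightarrow> nat \<Rightarrow> real) \<Rightarrow> (nat \<Rightarrow> nat \<Rightarrow> real)
      \<Rightarrow> (nat \<Rightarrow> nat \<Rightarrow> real) \<Rightarrow> real" where
  "oacc_objective m f T v w x =
     (\<Sum>t<T. \<Sum>j<m. v t j * x t j) - (\<Sum>j<m. f (\<Sum>t<T. w t j * x t j))"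

definition oacc_opt ::
    "nat \<Rightarrow> (real \<Rightarrow> real) \<Rightarrow> nat \<Rightarrow> (nat \<Rightarrow> nat \<Rightarrow> real) \<Rightarrow> (nat \<Rightarrow> nat \<Rightarrow> real) \<Rightarrow> real" where
  "oacc_opt m f T v w =
     (SUP x \<in> {x. \<forall>t<T. x t \<in> decisions m}. oacc_objective m f T v w x)"

definition utilization ::
    "(nat \<Rightarrow> nat \<Rightarrow> real) \<Rightarrow> (nat \<Rightarrow> nat \<Rightarrow> real) \<Rightarrow> nat \<Rightarrow> nat \<Rightarrow> real" where
  "utilization w x t j = (\<Sum>s<t. w s j * x s j)"

definition pseudo_utility ::
    "nat \<Rightarrow> (real \<Rightarrow> real) \<Rightarrow> (real \<Rightarrow> real) \<Rightarrow> (nat \<Rightarrow> real) \<Rightarrow> (nat \<Rightarrow> real) \<Rightarrow> (nat \<Rightarrow> real)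
      \<Rightarrow> (nat \<Rightarrow> real) \<Rightarrow> real" where
  "pseudo_utility m f \<phi> vt wt y x =
     (\<Sum>j<m. vt j * x j) -
     (\<Sum>j<m. integral {y j .. y j + wt j * x j} (\<lambda>\<eta>. cost_deriv f (\<phi> \<eta>)))"

definition pumax_run ::
    "nat \<Rightarrow> (real \<Rightarrow> real) \<Rightarrow> (real \<Rightarrow> real) \<Rightarrow> nat \<Rightarrow> (nat \<Rightarrow> nat \<Rightarrow> real) \<Rightarrow> (nat \<Rightarrow> nat \<Rightarrow> real)
      \<Rightarrow> (nat \<Rightarrow> nat \<Rightarrow> real) \<Rightarrow> bool" where
  "pumax_run m f \<phi> T v w x \<longleftrightarrow>
     (\<forall>t<T. x t \<in> decisions m \<and>
        (\<forall>z\<in>decisions m. pseudo_utility m f \<phi> (v t) (w t) (utilization w x t) z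
                        \<le> pseudo_utility m f \<phi> (v t) (w t) (utilization w x t) (x t)))"

text \<open>The guarantee is required for every way of breaking ties among the maximizers.\<close>

definition competitive_design ::
    "nat \<Rightarrow> real \<Rightarrow> (real \<Rightarrow> real) \<Rightarrow> (real \<Rightarrow> real) \<Rightarrow> bool" where
  "competitive_design m \<alpha> f \<phi> \<longleftrightarrow>
     (\<forall>T v w x. oacc_instance m T v w \<and> pumax_run m f \<phi> T v w x \<longrightarrow>
        oacc_opt m f T v w \<le> \<alpha> * oacc_objective m f T v w x)"

section \<open>Design spaces\<close>

text \<open>The right-hand side of the differential equation is \<open>0/0\<close> at \<open>y = 0\<close>, so the equation is
  imposed for \<open>y > 0\<close>; at \<open>0\<close> a design has a nonnegative right derivative.\<close>

definition design_space :: "real \<Rightarrow> (real \<Rightarrow> real) \<Rightarrow> (real \<Rightarrow> real) set" where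
  "design_space \<alpha> g =
     {\<phi>. \<phi> 0 = 0 \<and>
         (\<forall>y\<ge>0. \<phi> y \<ge> y \<and> \<phi> differentiable (at y within {0..}) \<and> cost_deriv \<phi> y \<ge> 0) \<and>
         (\<forall>y>0. cost_deriv \<phi> y =
            \<alpha> * ((cost_deriv g (\<phi> y) - cost_deriv g y) /
                 (\<phi> y * cost_deriv (cost_deriv g) (\<phi> y))))}"

definition design_region :: "real \<Rightarrow> (real \<Rightarrow> real) \<Rightarrow> (real \<times> real) set" where
  "design_region \<alpha> g = (\<Union>\<phi>\<in>design_space \<alpha> g. {(y, \<phi> y) | y. y \<ge> 0})"

definition universal_design_space ::
    "nat \<Rightarrow> real \<Rightarrow> (real \<Rightarrow> real) \<Rightarrow> (real \<Rightarrow> real) set \<Rightarrow> bool" where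
  "universal_design_space m \<alpha> fhat F \<longleftrightarrow>
     (\<forall>f\<in>F. design_region \<alpha> fhat \<subseteq> design_region \<alpha> f) \<and>
     (\<forall>\<phi>\<in>design_space \<alpha> fhat. competitive_design m \<alpha> fhat \<phi> \<longrightarrow>
        (\<forall>f\<in>F. competitive_design m \<alpha> f \<phi>))"

end

theory Submission
  imports Defs "HOL-Computational_Algebra.Polynomial"
begin

text \<open>On every piece the second elasticity of the envelope \<open>fhat\<close> is the maximum \<open>M\<close> of the second
  elasticities of the threshold costs, so \<open>M\<close> is continuous and nondecreasing, and \<open>fhat\<close> is three times
  continuously differentiable. The second elasticity of a polynomial is a weighted mean of the numbers
  \<open>k - 2\<close>, hence over a box of coefficients it is maximal at a threshold cost; thus \<open>M\<close> dominates
  it for every \<open>f\<close> in the class. Therefore \<open>fhat'' / f''\<close> is nondecreasing and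
  \<open>(fhat' z - fhat' y) / fhat'' z \<le> (f' z - f' y) / f'' z\<close> for \<open>y \<le> z\<close>: a design for \<open>fhat\<close> is a
  subsolution of the design equation of \<open>f\<close>. For \<open>\<alpha> \<ge> 1\<close> this differential inequality alone makes it
  \<open>\<alpha>\<close>-competitive for \<open>f\<close>, by the online primal-dual argument, and comparison shows that the
  solution of the equation of \<open>f\<close> through any point of its graph is a design.\<close>

section \<open>Calculus on the half-line\<close>

text \<open>The form C * g + L of the pieces is what lets the envelope carry the largest second
  elasticity: two differentiations remove the affine L, and the factor C cancels in y * f''' / f''.
  Hence C and L are free to match values and two derivatives. A design \<phi> for
  \<open>fhat\<close> is only a subsolution for f, so it need not belong to the design space of f.
  The two halves of universality are therefore proved separately: competitiveness directly for f,
  and inclusion of the regions by a new solution through each point. The obstacle there is the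
  origin, where the design equation is 0/0 and no solution can be started. Solutions are started at
  the given point and continued in both directions in the coordinates y = exp s, r = \<phi> y / y,
  which send the origin to minus infinity and make the equation globally Lipschitz. What must be
  recovered is the limit of r at minus infinity, the right derivative at 0. Comparison with \<phi>
  and with the diagonal keeps r bounded, and since f is a polynomial, the sign of the right-hand
  side at a fixed level is eventually constant.\<close>

lemma integral_has_real_derivative_half_line:
  fixes g :: "real \<Rightarrow> real"
  assumes "continuous_on {a..} g" and "a \<le> t"
  shows "((\<lambda>u. integral {a..u} g) has_real_derivative g t) (at t within {a..})"
proof -
  have "((\<lambda>u. integral {a..u} g) has_real_derivative g t) (at t within {a..t+1})"
    by (rule integral_has_real_derivative) (use assms in \<open>auto intro: continuous_on_subset\<close>)
  moreover have "at t within {a..t+1} = at t within {a..}"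
    by (rule at_within_nhd[of t "{..<t+1}"]) (use assms in auto)
  ultimately show ?thesis by simp
qed

lemma nondecreasing_within_half_line:
  fixes f :: "real \<Rightarrow> real"
  assumes "0 \<le> a" "a \<le> b"
    and der: "\<And>x. a \<le> x \<Longrightarrow> x \<le> b \<Longrightarrow> (f has_real_derivative f' x) (at x within {0..})"
    and nonneg: "\<And>x. a < x \<Longrightarrow> x < b \<Longrightarrow> 0 \<le> f' x"
  shows "f a \<le> f b"
proof (rule DERIV_nonneg_imp_increasing_open[OF \<open>a \<le> b\<close>])
  fix x assume x: "a < x" "x < b"
  then have "at x within {0..} = at x"
    using \<open>0 \<le> a\<close> by (intro at_within_interior) (auto simp: interior_Ici[of "-1"])
  with der[of x] nonneg[of x] x show "\<exists>y. (f has_real_derivative y) (at x) \<and> 0 \<le> y" by auto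
next
  show "continuous_on {a..b} f"
  proof (rule DERIV_continuous_on)
    fix x assume "x \<in> {a..b}"
    then show "(f has_real_derivative f' x) (at x within {a..b})"
      using der[of x] \<open>0 \<le> a\<close> by (auto intro: DERIV_subset)
  qed
qed

lemma increasing_within_half_line:
  fixes f :: "real \<Rightarrow> real"
  assumes "0 \<le> a" "a < b"
    and der: "\<And>x. a \<le> x \<Longrightarrow> x \<le> b \<Longrightarrow> (f has_real_derivative f' x) (at x within {0..})"
    and pos: "\<And>x. a < x \<Longrightarrow> x < b \<Longrightarrow> 0 < f' x"
  shows "f a < f b"
proof (rule DERIV_pos_imp_increasing_open[OF \<open>a < b\<close>])
  fix x assume x: "a < x" "x < b"
  then have "at x within {0..} = at x"
    using \<open>0 \<le> a\<close> by (intro at_within_interior) (auto simp: interior_Ici[of "-1"])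
  with der[of x] pos[of x] x show "\<exists>y. (f has_real_derivative y) (at x) \<and> 0 < y" by auto
next
  show "continuous_on {a..b} f"
  proof (rule DERIV_continuous_on)
    fix x assume "x \<in> {a..b}"
    then show "(f has_real_derivative f' x) (at x within {a..b})"
      using der[of x] \<open>0 \<le> a\<close> by (auto intro: DERIV_subset)
  qed
qed

lemma DERIV_within_finite_Union:
  fixes f :: "real \<Rightarrow> real"
  assumes "finite I" and "\<And>i. i \<in> I \<Longrightarrow> (f has_real_derivative D) (at x within P i)"
  shows "(f has_real_derivative D) (at x within (\<Union>i\<in>I. P i))"
  using assms
  unfolding has_field_derivative_iff
  by (induction I) (simp_all add: at_within_union filterlim_sup)

section \<open>Scalar differential equations\<close>

text \<open>Gronwall's argument, started at the last time t at which D is nonpositive: after t one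
  has |D| = D, so exp (- K * s) * D s cannot increase.\<close>

lemma comparison_nonpos:
  fixes D D' :: "real \<Rightarrow> real"
  assumes "a \<le> b"
    and der: "\<And>s. a \<le> s \<Longrightarrow> s \<le> b \<Longrightarrow> (D has_real_derivative D' s) (at s)"
    and le: "\<And>s. a \<le> s \<Longrightarrow> s \<le> b \<Longrightarrow> D' s \<le> K * \<bar>D s\<bar>"
    and "D a \<le> 0"
  shows "D b \<le> 0"
proof (rule ccontr)
  assume "\<not> D b \<le> 0"
  then have pos: "D b > 0" by simp
  have cont: "continuous_on {a..b} D"
    by (rule DERIV_continuous_on[where D = D']) (use der in \<open>auto intro: DERIV_subset\<close>)
  define Z where "Z = {x \<in> {a..b}. D x \<le> 0}"
  have "closed Z" unfolding Z_def
    by (rule continuous_on_closed_Collect_le) (use cont in auto)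
  moreover have "a \<in> Z" "bdd_above Z" using assms by (auto simp: Z_def bdd_above_def)
  ultimately have t: "Sup Z \<in> Z" by (intro closed_contains_Sup) auto
  define t where "t = Sup Z"
  have t0: "a \<le> t" "t \<le> b" "D t \<le> 0" using t by (auto simp: Z_def t_def)
  have gt: "D x > 0" if "t < x" "x \<le> b" for x
  proof (rule ccontr)
    assume "\<not> D x > 0"
    then have "x \<in> Z" using that t0 by (auto simp: Z_def)
    then show False using that cSup_upper[OF _ \<open>bdd_above Z\<close>] by (force simp: t_def)
  qed
  have "exp (- K * t) * D t \<ge> exp (- K * b) * D b"
  proof (rule DERIV_nonpos_imp_decreasing_open[OF \<open>t \<le> b\<close>])
    fix x assume x: "t < x" "x < b"
    have "((\<lambda>x. exp (- K * x) * D x) has_real_derivative exp (-K * x) * (D' x - K * D x)) (at x)"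
      using x t0 by (auto intro!: derivative_eq_intros der simp: algebra_simps)
    moreover have "exp (-K * x) * (D' x - K * D x) \<le> 0"
      using le[of x] gt[of x] x t0 by (intro mult_nonneg_nonpos) auto
    ultimately show "\<exists>y. ((\<lambda>x. exp (- K * x) * D x) has_real_derivative y) (at x) \<and> y \<le> 0" by blast
  next
    show "continuous_on {t..b} (\<lambda>x. exp (- K * x) * D x)"
      by (intro continuous_intros continuous_on_subset[OF cont]) (use t0 in auto)
  qed
  moreover have "exp (- K * t) * D t \<le> 0" using t0 by (simp add: mult_nonneg_nonpos)
  moreover have "exp (- K * b) * D b > 0" using pos by simp
  ultimately show False by linarith
qed

text \<open>Serves for comparison backwards in time: if two trajectories meet at b, a strict order
  at an earlier time a is impossible.\<close>

lemma comparison_neg: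
  fixes D D' :: "real \<Rightarrow> real"
  assumes "a \<le> b" and "K \<ge> 0"
    and der: "\<And>s. a \<le> s \<Longrightarrow> s \<le> b \<Longrightarrow> (D has_real_derivative D' s) (at s)"
    and le: "\<And>s. a \<le> s \<Longrightarrow> s \<le> b \<Longrightarrow> D' s \<le> K * \<bar>D s\<bar>"
    and "D a < 0"
  shows "D b < 0"
proof -
  \<comment> \<open>e solves e' = - K * e with e a = - D a, so D + e starts at 0 and inherits the
    differential inequality.\<close>
  define e where "e s = - D a * exp (- K * (s - a))" for s
  have epos: "e s > 0" for s using \<open>D a < 0\<close> by (simp add: e_def mult_neg_pos)
  have "D b + e b \<le> 0"
  proof (rule comparison_nonpos[OF \<open>a \<le> b\<close>, where D = "\<lambda>s. D s + e s"
        and D' = "\<lambda>s. D' s - K * e s" and K = K])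
    fix s assume s: "a \<le> s" "s \<le> b"
    show "((\<lambda>s. D s + e s) has_real_derivative D' s - K * e s) (at s)"
      unfolding e_def by (auto intro!: derivative_eq_intros der s)
    have "\<bar>D s\<bar> \<le> \<bar>D s + e s\<bar> + e s" using epos[of s] by linarith
    then have "K * \<bar>D s\<bar> \<le> K * (\<bar>D s + e s\<bar> + e s)" using \<open>K \<ge> 0\<close> by (rule mult_left_mono)
    then show "D' s - K * e s \<le> K * \<bar>D s + e s\<bar>" using le[OF s] by (simp add: algebra_simps)
  qed (simp add: e_def)
  then show ?thesis using epos[of b] by linarith
qed

text \<open>Picard iteration for \<open>exp (- L * t) * x t\<close> in place of \<open>x\<close>: with this weight the integral
  operator is a contraction on the whole half-line at once.\<close>
lemma picard_forward:
  fixes F :: "real \<Rightarrow> real \<Rightarrow> real"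
  assumes cont: "continuous_on UNIV (\<lambda>z. F (fst z) (snd z))"
    and "K \<ge> 0" and lip: "\<And>s x y. \<bar>F s x - F s y\<bar> \<le> K * \<bar>x - y\<bar>"
    and bd: "\<And>s. \<bar>F s 0\<bar> \<le> M"
  obtains x where "x 0 = x0" "\<And>t. t \<ge> 0 \<Longrightarrow> (x has_real_derivative F t (x t)) (at t within {0..})"
proof -
  \<comment> \<open>With this weight the contraction factor K / L is at most 1/2.\<close>
  define L where "L = 2 * K + 1"
  have L: "L > 0" "2 * K \<le> L" using \<open>K \<ge> 0\<close> by (auto simp: L_def)
  have "M \<ge> 0" using bd[of 0] by linarith
  define g where "g u s = F s (exp (L * s) * apply_bcontfun u s)" for u :: "real \<Rightarrow>\<^sub>C real" and s
  have gcont: "continuous_on A (g u)" for A u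
  proof -
    have "continuous_on UNIV (\<lambda>s. (s, exp (L * s) * apply_bcontfun u s))"
      by (intro continuous_intros) auto
    from continuous_on_compose2[OF cont this]
    show ?thesis unfolding g_def by (auto intro: continuous_on_subset)
  qed
  have gint: "g u integrable_on {0..t}" for u t
    by (rule integrable_continuous_real[OF gcont])
  \<comment> \<open>\<open>max 0 t\<close> freezes the functions at negative times, so that the
    fixed point can be sought among bounded continuous functions on the whole line.\<close>
  define T0 where "T0 u t = exp (- L * max 0 t) * (x0 + integral {0..max 0 t} (g u))" for u t
  have expint: "((\<lambda>s. c * exp (L * s)) has_integral c / L * (exp (L * t) - 1)) {0..t}"
    if "t \<ge> 0" for c t
  proof -
    have "((\<lambda>s. c * exp (L * s)) has_integral c / L * exp (L * t) - c / L * exp (L * 0)) {0..t}"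
      by (rule fundamental_theorem_of_calculus[OF that])
        (use L in \<open>auto intro!: derivative_eq_intros simp flip: has_real_derivative_iff_has_vector_derivative\<close>)
    then show ?thesis by (simp add: right_diff_distrib)
  qed
  have weight: "exp (- L * t) * (c / L * (exp (L * t) - 1)) \<le> c / L" if "c \<ge> 0" "t \<ge> 0" for c t
  proof -
    have "exp (- L * t) * (c / L * (exp (L * t) - 1)) = c / L * (1 - exp (- L * t))"
      by (simp add: algebra_simps flip: exp_add)
    also have "\<dots> \<le> c / L * 1" using that L by (intro mult_left_mono) auto
    finally show ?thesis by simp
  qed
  have gbd: "\<bar>g u s\<bar> \<le> (M + K * norm u) * exp (L * s)" if "s \<ge> 0" for u s
  proof -
    have "\<bar>g u s\<bar> \<le> \<bar>F s 0\<bar> + K * \<bar>exp (L * s) * apply_bcontfun u s\<bar>"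
      using lip[of s "exp (L * s) * apply_bcontfun u s" 0] by (simp add: g_def)
    also have "\<dots> \<le> M * exp (L * s) + K * (exp (L * s) * norm u)"
    proof (intro add_mono mult_left_mono)
      have "1 \<le> exp (L * s)" using that L by simp
      then have "M * 1 \<le> M * exp (L * s)" using \<open>M \<ge> 0\<close> by (intro mult_left_mono)
      then show "\<bar>F s 0\<bar> \<le> M * exp (L * s)" using bd[of s] by linarith
      show "\<bar>exp (L * s) * apply_bcontfun u s\<bar> \<le> exp (L * s) * norm u"
        using norm_bounded[of u s] by (simp add: abs_mult)
    qed (fact \<open>K \<ge> 0\<close>)
    finally show ?thesis by (simp add: algebra_simps)
  qed
  have T0in: "T0 u \<in> bcontfun" for u
  proof (rule bcontfun_normI)
    have "continuous_on {0..} (\<lambda>t. integral {0..t} (g u))"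
      by (rule DERIV_continuous_on[OF integral_has_real_derivative_half_line]) (auto intro: gcont)
    moreover have "continuous_on UNIV (\<lambda>t::real. max 0 t)" by (intro continuous_intros)
    ultimately have "continuous_on UNIV (\<lambda>t. integral {0..max 0 t} (g u))"
      by (rule continuous_on_compose2) auto
    then show "continuous_on UNIV (T0 u)" unfolding T0_def by (intro continuous_intros)
    fix t :: real
    define t' where "t' = max 0 t"
    have t': "t' \<ge> 0" by (simp add: t'_def)
    let ?c = "M + K * norm u"
    have c: "?c \<ge> 0" using \<open>M \<ge> 0\<close> \<open>K \<ge> 0\<close> by simp
    have "\<bar>integral {0..t'} (g u)\<bar> \<le> ?c / L * (exp (L * t') - 1)"
      using integral_norm_bound_integral[OF gint has_integral_integrable[OF expint[OF t', of ?c]], of u]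
        gbd integral_unique[OF expint[OF t', of ?c]] by auto
    then have "exp (- L * t') * \<bar>integral {0..t'} (g u)\<bar> \<le> exp (- L * t') * (?c / L * (exp (L * t') - 1))"
      by (intro mult_left_mono) auto
    also have "\<dots> \<le> ?c / L" by (rule weight[OF c t'])
    finally have 1: "exp (- L * t') * \<bar>integral {0..t'} (g u)\<bar> \<le> ?c / L" .
    have 2: "exp (- L * t') * \<bar>x0\<bar> \<le> 1 * \<bar>x0\<bar>"
      by (intro mult_right_mono) (use t' L in auto)
    have "\<bar>T0 u t\<bar> \<le> exp (- L * t') * (\<bar>x0\<bar> + \<bar>integral {0..t'} (g u)\<bar>)"
      unfolding T0_def t'_def[symmetric] abs_mult by (intro mult_mono) auto
    with 1 2 show "norm (T0 u t) \<le> \<bar>x0\<bar> + ?c / L" by (simp add: distrib_left)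
  qed
  define T where "T u = Bcontfun (T0 u)" for u
  have T: "apply_bcontfun (T u) = T0 u" for u
    unfolding T_def by (rule Bcontfun_inverse[OF T0in])
  have "dist (T u) (T v) \<le> 1/2 * dist u v" for u v
  proof (rule dist_bound)
    fix t :: real
    define t' where "t' = max 0 t"
    have t': "t' \<ge> 0" by (simp add: t'_def)
    let ?c = "K * dist u v"
    have c: "?c \<ge> 0" using \<open>K \<ge> 0\<close> by simp
    have gd: "\<bar>g u s - g v s\<bar> \<le> ?c * exp (L * s)" for s
    proof -
      have "\<bar>g u s - g v s\<bar> \<le> K * \<bar>exp (L * s) * (apply_bcontfun u s - apply_bcontfun v s)\<bar>"
        using lip[of s "exp (L * s) * apply_bcontfun u s" "exp (L * s) * apply_bcontfun v s"]
        by (simp add: g_def right_diff_distrib)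
      also have "\<dots> \<le> K * (exp (L * s) * dist u v)"
        using dist_bounded[of u s v] \<open>K \<ge> 0\<close> by (intro mult_left_mono) (auto simp: abs_mult dist_real_def)
      finally show ?thesis by (simp add: algebra_simps)
    qed
    have "\<bar>integral {0..t'} (\<lambda>s. g u s - g v s)\<bar> \<le> ?c / L * (exp (L * t') - 1)"
      using integral_norm_bound_integral[OF integrable_diff[OF gint gint]
          has_integral_integrable[OF expint[OF t', of ?c]], of u v]
        gd integral_unique[OF expint[OF t', of ?c]] by auto
    then have "exp (- L * t') * \<bar>integral {0..t'} (\<lambda>s. g u s - g v s)\<bar>
       \<le> exp (- L * t') * (?c / L * (exp (L * t') - 1))"
      by (intro mult_left_mono) auto
    also have "\<dots> \<le> ?c / L" by (rule weight[OF c t'])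
    also have "\<dots> = K / L * dist u v" by simp
    also have "\<dots> \<le> 1/2 * dist u v"
      using L by (intro mult_right_mono) (auto simp: field_simps)
    finally have "exp (- L * t') * \<bar>integral {0..t'} (\<lambda>s. g u s - g v s)\<bar> \<le> 1/2 * dist u v" .
    moreover have "dist (T u t) (T v t) = exp (- L * t') * \<bar>integral {0..t'} (\<lambda>s. g u s - g v s)\<bar>"
      unfolding T T0_def t'_def[symmetric] dist_real_def
      by (subst integral_diff[OF gint gint]) (simp add: abs_mult flip: right_diff_distrib)
    ultimately show "dist (T u t) (T v t) \<le> 1/2 * dist u v" by simp
  qed
  then obtain u where u: "T u = u"
    using banach_fix_type[of "1/2" T] by auto
  define x where "x t = x0 + integral {0..t} (g u)" for t
  have ux: "exp (L * t) * apply_bcontfun u t = x t" if "t \<ge> 0" for t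
    using arg_cong[OF u, of "\<lambda>u. apply_bcontfun u t"] that
    by (simp add: T T0_def x_def exp_minus field_simps)
  show ?thesis
  proof
    show "x 0 = x0" by (simp add: x_def)
    fix t :: real assume t: "t \<ge> 0"
    have "(x has_real_derivative 0 + g u t) (at t within {0..})"
      unfolding x_def by (intro DERIV_add DERIV_const integral_has_real_derivative_half_line gcont t)
    then show "(x has_real_derivative F t (x t)) (at t within {0..})"
      using ux[OF t] by (simp add: g_def)
  qed
qed

text \<open>The equation is solved forwards from s0, and backwards through the reversed field - F
  (s0 - t); at s0 both one-sided derivatives equal F s0 x0.\<close>

lemma picard_global:
  fixes F :: "real \<Rightarrow> real \<Rightarrow> real"
  assumes cont: "continuous_on UNIV (\<lambda>z. F (fst z) (snd z))"
    and "K \<ge> 0" and lip: "\<And>s x y. \<bar>F s x - F s y\<bar> \<le> K * \<bar>x - y\<bar>"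
    and bd: "\<And>s. \<bar>F s 0\<bar> \<le> M"
  obtains x where "x s0 = x0" "\<And>t. (x has_real_derivative F t (x t)) (at t)"
proof -
  have c1: "continuous_on UNIV (\<lambda>z. F (s0 + fst z) (snd z))"
    by (rule continuous_on_compose2[OF cont, of _ "\<lambda>z. (s0 + fst z, snd z)", simplified])
      (intro continuous_intros)
  have c2: "continuous_on UNIV (\<lambda>z. - F (s0 - fst z) (snd z))"
    by (intro continuous_intros continuous_on_compose2[OF cont, of _ "\<lambda>z. (s0 - fst z, snd z)", simplified])
  obtain p where p: "p 0 = x0" "\<And>t. t \<ge> 0 \<Longrightarrow> (p has_real_derivative F (s0 + t) (p t)) (at t within {0..})"
    using picard_forward[OF c1 \<open>K \<ge> 0\<close>, of M x0] lip bd by blast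
  obtain n where n: "n 0 = x0" "\<And>t. t \<ge> 0 \<Longrightarrow> (n has_real_derivative - F (s0 - t) (n t)) (at t within {0..})"
    using picard_forward[OF c2 \<open>K \<ge> 0\<close>, of M x0] lip bd by (auto simp: abs_minus_commute)
  define x where "x t = (if t \<ge> s0 then p (t - s0) else n (s0 - t))" for t
  have xl: "x t = n (s0 - t)" if "t \<le> s0" for t using that p n by (auto simp: x_def)
  have R: "(x has_real_derivative F t (x t)) (at t within {s0..})" if "t \<ge> s0" for t
  proof -
    have "((\<lambda>t. p (t - s0)) has_real_derivative F (s0 + (t - s0)) (p (t - s0)) * 1) (at t within {s0..})"
      by (rule DERIV_image_chain[of p, unfolded o_def])
        (use that p(2)[of "t - s0"] in \<open>auto intro!: derivative_eq_intros elim: DERIV_subset\<close>)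
    then have "((\<lambda>t. p (t - s0)) has_real_derivative F t (x t)) (at t within {s0..})"
      using that by (simp add: x_def)
    then show ?thesis
      by (rule has_field_derivative_transform_within[of _ _ _ _ 1]) (use that in \<open>auto simp: x_def\<close>)
  qed
  have Lf: "(x has_real_derivative F t (x t)) (at t within {..s0})" if "t \<le> s0" for t
  proof -
    have "((\<lambda>t. n (s0 - t)) has_real_derivative - F (s0 - (s0 - t)) (n (s0 - t)) * (-1)) (at t within {..s0})"
      by (rule DERIV_image_chain[of n, unfolded o_def])
        (use that n(2)[of "s0 - t"] in \<open>auto intro!: derivative_eq_intros elim: DERIV_subset\<close>)
    then have "((\<lambda>t. n (s0 - t)) has_real_derivative F t (x t)) (at t within {..s0})"
      using that by (simp add: xl)
    then show ?thesis
      by (rule has_field_derivative_transform_within[of _ _ _ _ 1]) (use that in \<open>auto simp: xl\<close>)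
  qed
  show ?thesis
  proof
    show "x s0 = x0" by (simp add: x_def p)
    fix t
    show "(x has_real_derivative F t (x t)) (at t)"
    proof (cases t s0 rule: linorder_cases)
      case less
      then have "at t within {..s0} = at t" by (intro at_within_interior) (auto simp: interior_Iic[of "s0+1"])
      with Lf[of t] less show ?thesis by simp
    next
      case greater
      then have "at t within {s0..} = at t" by (intro at_within_interior) (auto simp: interior_Ici[of "s0-1"])
      with R[of t] greater show ?thesis by simp
    next
      case equal
      have "(x has_real_derivative F t (x t)) (at t within (\<Union>b\<in>UNIV. if b then {s0..} else {..s0}))"
        by (rule DERIV_within_finite_Union) (use equal R Lf in auto)
      moreover have "(\<Union>b\<in>UNIV. if b then {s0..} else {..s0}) = UNIV" by (auto simp: UNIV_bool)
      ultimately show ?thesis by simp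
    qed
  qed
qed

text \<open>A trajectory that can cross each level in one direction only does not oscillate.\<close>
lemma convergent_at_bot_if_no_crossing:
  fixes r :: "real \<Rightarrow> real"
  assumes bd: "\<forall>\<^sub>F s in at_bot. a \<le> r s \<and> r s \<le> b"
    and dich: "\<And>q. a < q \<Longrightarrow> (\<forall>\<^sub>F s in at_bot. q \<le> r s) \<or> (\<forall>\<^sub>F s in at_bot. r s \<le> q)"
  obtains l where "a \<le> l" "(r \<longlongrightarrow> l) at_bot"
proof
  \<comment> \<open>S collects the eventual lower bounds, so Sup S is the lower limit of r; by the
    dichotomy every level above it is an eventual upper bound.\<close>
  define S where "S = {q. \<forall>\<^sub>F s in at_bot. q \<le> r s}"
  have "a \<in> S" using bd unfolding S_def by (auto elim: eventually_mono)
  have ub: "q \<le> b" if "q \<in> S" for q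
  proof -
    have "\<forall>\<^sub>F s::real in at_bot. q \<le> b"
      using eventually_conj[OF that[unfolded S_def mem_Collect_eq] bd] by (rule eventually_mono) auto
    then show ?thesis by simp
  qed
  then have "bdd_above S" by (auto simp: bdd_above_def)
  show "a \<le> Sup S" using \<open>a \<in> S\<close> \<open>bdd_above S\<close> by (rule cSup_upper)
  show "(r \<longlongrightarrow> Sup S) at_bot"
  proof (rule order_tendstoI)
    fix x assume "x < Sup S"
    then obtain q where "q \<in> S" "x < q" using less_cSup_iff[of S x] \<open>a \<in> S\<close> \<open>bdd_above S\<close> by auto
    then show "\<forall>\<^sub>F s in at_bot. x < r s" unfolding S_def by (auto elim: eventually_mono)
  next
    fix x assume x: "Sup S < x"
    then obtain q where q: "Sup S < q" "q < x" using dense by blast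
    then have "q \<notin> S" using cSup_upper[OF _ \<open>bdd_above S\<close>] by force
    then have "\<forall>\<^sub>F s in at_bot. r s \<le> q" using dich[of q] q \<open>a \<le> Sup S\<close> by (auto simp: S_def)
    then show "\<forall>\<^sub>F s in at_bot. r s < x" by (rule eventually_mono) (use q in auto)
  qed
qed

section \<open>Iterated derivatives on the half-line\<close>

lemma cost_deriv_eqI:
  assumes "(f has_real_derivative D) (at y within {0..})" "0 \<le> y"
  shows "cost_deriv f y = D"
  unfolding cost_deriv_def
proof (rule vector_derivative_within)
  have "at_right y \<le> at y within {0..}" using assms(2) by (intro at_le) auto
  then show "at y within {0..} \<noteq> bot"
    using trivial_limit_at_right_real[of y] by (metis bot.extremum_uniqueI)
qed (use assms in \<open>simp add: has_real_derivative_iff_has_vector_derivative\<close>)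

lemma has_real_derivative_cong_half_line:
  fixes f :: "real \<Rightarrow> real"
  assumes "(f has_real_derivative D) (at y within {0..})" "0 \<le> y" "\<And>x. 0 \<le> x \<Longrightarrow> g x = f x"
  shows "(g has_real_derivative D) (at y within {0..})"
  using assms(1) by (rule has_field_derivative_transform_within[of _ _ _ _ 1]) (use assms in auto)

text \<open>The iterates of \<open>cost_deriv\<close> are controlled only at nonnegative arguments,
  so they are compared there with a chain h of explicit derivatives.\<close>

lemma funpow_cost_deriv_eq:
  assumes "\<And>y. 0 \<le> y \<Longrightarrow> f y = h 0 y"
    and "\<And>j y. j < n \<Longrightarrow> 0 \<le> y \<Longrightarrow> (h j has_real_derivative h (Suc j) y) (at y within {0..})"
    and "j \<le> n" "0 \<le> y"
  shows "(cost_deriv ^^ j) f y = h j y"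
  using assms(3,4)
proof (induction j arbitrary: y)
  case 0
  then show ?case using assms(1) by simp
next
  case (Suc j)
  have "((cost_deriv ^^ j) f has_real_derivative h (Suc j) y) (at y within {0..})"
    by (rule has_real_derivative_cong_half_line[OF assms(2)]) (use Suc in auto)
  then show ?case using Suc by (simp add: cost_deriv_eqI)
qed

lemma funpow_cost_deriv_poly:
  assumes "\<And>y. 0 \<le> y \<Longrightarrow> f y = poly p y" "0 \<le> y"
  shows "(cost_deriv ^^ j) f y = poly ((pderiv ^^ j) p) y"
  by (rule funpow_cost_deriv_eq[where h = "\<lambda>j. poly ((pderiv ^^ j) p)" and n = j])
    (use assms in \<open>auto intro: DERIV_subset[OF poly_DERIV]\<close>)

lemma elasticity_second_deriv:
  "elasticity (cost_deriv (cost_deriv f)) y = y * (cost_deriv ^^ 3) f y / (cost_deriv ^^ 2) f y"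
  by (simp add: elasticity_def numeral_2_eq_2 numeral_3_eq_3)

section \<open>Polynomial costs and their second elasticity\<close>

definition cost_poly :: "nat \<Rightarrow> nat \<Rightarrow> (nat \<Rightarrow> real) \<Rightarrow> real poly" where
  "cost_poly \<tau> \<sigma> c = (\<Sum>k=\<tau>..\<sigma>. monom (c k) k)"

text \<open>The k-th term of y^2 * f''. The factor y^2 keeps the exponent k, so no truncated k - 2
  occurs, and degrees 0 and 1 get weight 0 by themselves.\<close>

definition weight2 :: "(nat \<Rightarrow> real) \<Rightarrow> real \<Rightarrow> nat \<Rightarrow> real" where
  "weight2 c y k = real k * (real k - 1) * c k * y ^ k"

definition elast2 :: "nat \<Rightarrow> nat \<Rightarrow> (nat \<Rightarrow> real) \<Rightarrow> real \<Rightarrow> real" where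
  "elast2 \<tau> \<sigma> c y = (\<Sum>k=\<tau>..\<sigma>. (real k - 2) * weight2 c y k) / (\<Sum>k=\<tau>..\<sigma>. weight2 c y k)"

lemma poly_cost_poly: "poly (cost_poly \<tau> \<sigma> c) y = poly_cost \<tau> \<sigma> c y"
  by (simp add: cost_poly_def poly_cost_def poly_sum poly_monom)

lemma pderiv2_eq: "(pderiv ^^ 2) p = pderiv (pderiv p)"
  by (simp add: numeral_2_eq_2)

lemma pderiv3_eq: "(pderiv ^^ 3) p = pderiv (pderiv (pderiv p))"
  by (simp add: numeral_3_eq_3)

lemma pderiv2_cost_poly:
  "y ^ 2 * poly ((pderiv ^^ 2) (cost_poly \<tau> \<sigma> c)) y = (\<Sum>k=\<tau>..\<sigma>. weight2 c y k)"
proof -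
  have "y ^ 2 * poly ((pderiv ^^ 2) (monom (c k) k)) y = weight2 c y k" for k
  proof (cases "k \<ge> 2")
    case True
    then obtain j where "k = j + 2" using le_Suc_ex[of 2 k] by auto
    then show ?thesis
      by (simp add: pderiv2_eq pderiv_monom poly_monom weight2_def algebra_simps power2_eq_square)
  next
    case False
    then have "k = 0 \<or> k = 1" by auto
    then show ?thesis by (auto simp: pderiv2_eq pderiv_monom poly_monom weight2_def)
  qed
  then show ?thesis
    by (simp add: cost_poly_def higher_pderiv_sum poly_sum sum_distrib_left)
qed

lemma pderiv3_cost_poly:
  "y ^ 3 * poly ((pderiv ^^ 3) (cost_poly \<tau> \<sigma> c)) y = (\<Sum>k=\<tau>..\<sigma>. (real k - 2) * weight2 c y k)"
proof -
  have "y ^ 3 * poly ((pderiv ^^ 3) (monom (c k) k)) y = (real k - 2) * weight2 c y k" for k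
  proof (cases "k \<ge> 3")
    case True
    then obtain j where "k = j + 3" using le_Suc_ex[of 3 k] by auto
    then show ?thesis
      by (simp add: pderiv3_eq pderiv_monom poly_monom weight2_def algebra_simps power_add power3_eq_cube)
  next
    case False
    then have "k = 0 \<or> k = 1 \<or> k = 2" by auto
    then show ?thesis by (auto simp: pderiv3_eq pderiv_monom poly_monom weight2_def)
  qed
  then show ?thesis
    by (simp add: cost_poly_def higher_pderiv_sum poly_sum sum_distrib_left)
qed

lemma weight2_nonneg:
  assumes "poly_coeffs \<tau> \<sigma> c" "k \<in> {\<tau>..\<sigma>}" "0 \<le> y"
  shows "0 \<le> weight2 c y k"
proof -
  have "real k * (real k - 1) \<ge> 0" by (cases k) auto
  then show ?thesis using assms by (auto simp: weight2_def poly_coeffs_def)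
qed

lemma weight2_eq_0: "k < 2 \<Longrightarrow> weight2 c y k = 0"
  using less_2_cases[of k] by (auto simp: weight2_def)

locale cost_bounds =
  fixes \<tau> \<sigma> :: nat
  assumes tau: "1 \<le> \<tau>" "\<tau> \<le> \<sigma>" and sigma: "1 < \<sigma>"
begin

lemma sum_weight2_pos:
  assumes "poly_coeffs \<tau> \<sigma> c" "0 < y"
  shows "0 < (\<Sum>k=\<tau>..\<sigma>. weight2 c y k)"
  using tau sigma assms
  by (intro sum_pos2[of _ \<sigma>] weight2_nonneg) (auto simp: weight2_def poly_coeffs_def)

lemma pderiv2_pos:
  assumes "poly_coeffs \<tau> \<sigma> c" "0 < y"
  shows "0 < poly ((pderiv ^^ 2) (cost_poly \<tau> \<sigma> c)) y"
  using sum_weight2_pos[OF assms] assms(2) unfolding pderiv2_cost_poly[symmetric]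
  by (simp add: zero_less_mult_iff)

lemma pderiv3_elast2:
  assumes "poly_coeffs \<tau> \<sigma> c" "0 < y"
  shows "y * poly ((pderiv ^^ 3) (cost_poly \<tau> \<sigma> c)) y
    = elast2 \<tau> \<sigma> c y * poly ((pderiv ^^ 2) (cost_poly \<tau> \<sigma> c)) y"
proof -
  have "elast2 \<tau> \<sigma> c y = (y ^ 3 * poly ((pderiv ^^ 3) (cost_poly \<tau> \<sigma> c)) y)
      / (y ^ 2 * poly ((pderiv ^^ 2) (cost_poly \<tau> \<sigma> c)) y)"
    by (simp add: elast2_def pderiv2_cost_poly pderiv3_cost_poly)
  then show ?thesis
    using pderiv2_pos[OF assms] assms(2) by (simp add: field_simps power2_eq_square power3_eq_cube)
qed

lemma elasticity_poly_cost:
  assumes "poly_coeffs \<tau> \<sigma> c" "0 < y"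
  shows "elasticity (cost_deriv (cost_deriv (poly_cost \<tau> \<sigma> c))) y = elast2 \<tau> \<sigma> c y"
proof -
  have "(cost_deriv ^^ j) (poly_cost \<tau> \<sigma> c) y = poly ((pderiv ^^ j) (cost_poly \<tau> \<sigma> c)) y" for j
    by (rule funpow_cost_deriv_poly) (use assms in \<open>auto simp: poly_cost_poly\<close>)
  then show ?thesis
    unfolding elasticity_second_deriv using pderiv3_elast2[OF assms] pderiv2_pos[OF assms] by simp
qed

text \<open>A mean of the numbers k - 2 lies between the extreme ones. It is nonnegative even for
  \<tau> = 1, because degrees below 2 carry weight 0.\<close>

lemma elast2_bounds:
  assumes "poly_coeffs \<tau> \<sigma> c" "0 < y"
  shows "0 \<le> elast2 \<tau> \<sigma> c y" "real \<tau> - 2 \<le> elast2 \<tau> \<sigma> c y" "elast2 \<tau> \<sigma> c y \<le> real \<sigma> - 2"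
proof -
  note pos = sum_weight2_pos[OF assms]
  have nn: "0 \<le> weight2 c y k" if "k \<in> {\<tau>..\<sigma>}" for k using weight2_nonneg assms that by auto
  have "0 \<le> (\<Sum>k=\<tau>..\<sigma>. (real k - 2) * weight2 c y k)"
  proof (rule sum_nonneg)
    fix k assume "k \<in> {\<tau>..\<sigma>}"
    then show "0 \<le> (real k - 2) * weight2 c y k" using nn[of k] weight2_eq_0[of k] by (cases "k < 2") auto
  qed
  then show "0 \<le> elast2 \<tau> \<sigma> c y" using pos by (simp add: elast2_def)
  have "(real \<tau> - 2) * (\<Sum>k=\<tau>..\<sigma>. weight2 c y k) \<le> (\<Sum>k=\<tau>..\<sigma>. (real k - 2) * weight2 c y k)"
    unfolding sum_distrib_left by (intro sum_mono mult_right_mono nn) auto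
  then show "real \<tau> - 2 \<le> elast2 \<tau> \<sigma> c y" using pos by (simp add: elast2_def pos_le_divide_eq)
  have "(\<Sum>k=\<tau>..\<sigma>. (real k - 2) * weight2 c y k) \<le> (real \<sigma> - 2) * (\<Sum>k=\<tau>..\<sigma>. weight2 c y k)"
    unfolding sum_distrib_left by (intro sum_mono mult_right_mono nn) auto
  then show "elast2 \<tau> \<sigma> c y \<le> real \<sigma> - 2" using pos by (simp add: elast2_def pos_divide_le_eq)
qed

text \<open>Passing from y to z multiplies the weight of k by (z / y) ^ k, which increases with k
  and so moves the mean up. After cross-multiplication this is Chebyshev's sum inequality.\<close>

lemma elast2_mono:
  assumes c: "poly_coeffs \<tau> \<sigma> c" and y: "0 < y" "y \<le> z"
  shows "elast2 \<tau> \<sigma> c y \<le> elast2 \<tau> \<sigma> c z"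
proof -
  have z: "0 < z" using y by simp
  let ?A = "{\<tau>..\<sigma>}" and ?u = "weight2 c y" and ?v = "weight2 c z"
  define a where "a k = real k * (real k - 1) * c k" for k
  have u: "?u k = a k * y ^ k" and v: "?v k = a k * z ^ k" for k by (auto simp: weight2_def a_def)
  have a: "a k \<ge> 0" if "k \<in> ?A" for k
    using weight2_nonneg[OF c that, of 1] by (simp add: weight2_def a_def)
  have key: "0 \<le> (real k - real l) * (a k * a l * (z ^ k * y ^ l - y ^ k * z ^ l))"
    if "k \<in> ?A" "l \<in> ?A" for k l
  proof -
    have main: "0 \<le> (real i - real j) * (z ^ i * y ^ j - y ^ i * z ^ j)" if ji: "j \<le> i" for i j
    proof -
      obtain d where d: "i = j + d" using le_Suc_ex[OF ji] by blast
      have "z ^ i * y ^ j - y ^ i * z ^ j = (z * y) ^ j * (z ^ d - y ^ d)"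
        by (simp add: d power_add power_mult_distrib algebra_simps)
      moreover have "y ^ d \<le> z ^ d" using y by (intro power_mono) auto
      ultimately show ?thesis using y ji by (auto intro!: mult_nonneg_nonneg)
    qed
    have "0 \<le> (real k - real l) * (z ^ k * y ^ l - y ^ k * z ^ l)"
      using main[of l k] main[of k l] by (cases "l \<le> k") (auto simp: algebra_simps)
    with mult_nonneg_nonneg[OF a[OF that(1)] a[OF that(2)]]
    have "0 \<le> (a k * a l) * ((real k - real l) * (z ^ k * y ^ l - y ^ k * z ^ l))"
      by (rule mult_nonneg_nonneg)
    then show ?thesis by (simp only: mult_ac)
  qed
  let ?X = "\<Sum>k\<in>?A. \<Sum>l\<in>?A. (real k - 2) * (a k * a l * (z ^ k * y ^ l - y ^ k * z ^ l))"
  \<comment> \<open>Adding the copy with k and l exchanged turns the factor k - 2 into k - l, whose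
    sign agrees with that of the bracket.\<close>
  have "?X + ?X = ?X + (\<Sum>k\<in>?A. \<Sum>l\<in>?A. (real l - 2) * (a l * a k * (z ^ l * y ^ k - y ^ l * z ^ k)))"
    by (rule arg_cong2[where f = "(+)", OF refl sum.swap])
  also have "\<dots> = (\<Sum>k\<in>?A. \<Sum>l\<in>?A. (real k - real l) * (a k * a l * (z ^ k * y ^ l - y ^ k * z ^ l)))"
    unfolding sum.distrib[symmetric] by (intro sum.cong refl) (simp add: algebra_simps)
  finally have "?X + ?X = (\<Sum>k\<in>?A. \<Sum>l\<in>?A. (real k - real l) * (a k * a l * (z ^ k * y ^ l - y ^ k * z ^ l)))" .
  moreover have "0 \<le> (\<Sum>k\<in>?A. \<Sum>l\<in>?A. (real k - real l) * (a k * a l * (z ^ k * y ^ l - y ^ k * z ^ l)))"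
    by (intro sum_nonneg key)
  ultimately have X: "0 \<le> ?X" by linarith
  have "?X = (\<Sum>k\<in>?A. (real k - 2) * ?v k) * (\<Sum>l\<in>?A. ?u l)
      - (\<Sum>k\<in>?A. (real k - 2) * ?u k) * (\<Sum>l\<in>?A. ?v l)"
    unfolding sum_product sum_subtractf[symmetric] u v
    by (intro sum.cong refl) (simp add: algebra_simps)
  with X show ?thesis
    using sum_weight2_pos[OF c \<open>0 < y\<close>] sum_weight2_pos[OF c z]
    unfolding elast2_def
    by (subst frac_le_eq) (auto intro!: divide_nonpos_pos simp: mult.commute)
qed

lemma poly_coeffs_threshold:
  assumes "\<forall>k\<in>{\<tau>..\<sigma>}. 0 \<le> lo k \<and> lo k \<le> hi k" "0 < lo \<tau>" "0 < lo \<sigma>" "\<tau> \<le> d" "d < \<sigma>"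
  shows "poly_coeffs \<tau> \<sigma> (\<lambda>k. if k \<le> d then lo k else hi k)"
proof -
  have "0 < hi \<sigma>" using assms(1,3) tau by (meson atLeastAtMost_iff less_le_trans order_refl)
  moreover have "0 \<le> hi k" if "k \<in> {\<tau>..\<sigma>}" for k using assms(1) that order_trans by blast
  ultimately show ?thesis using assms by (auto simp: poly_coeffs_def)
qed

text \<open>\<open>elast2\<close> is a weighted mean of the numbers \<open>k - 2\<close>. It increases when the weights below the
  mean are lowered and those above it are raised.\<close>
lemma elast2_le_threshold:
  assumes lohi: "\<forall>k\<in>{\<tau>..\<sigma>}. 0 \<le> lo k \<and> lo k \<le> hi k" "0 < lo \<tau>" "0 < lo \<sigma>" and "\<tau> < \<sigma>"
    and c: "poly_coeffs \<tau> \<sigma> c" "\<forall>k\<in>{\<tau>..\<sigma>}. lo k \<le> c k \<and> c k \<le> hi k" and y: "0 < y"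
  obtains d where "d \<in> {\<tau>..<\<sigma>}" "elast2 \<tau> \<sigma> c y \<le> elast2 \<tau> \<sigma> (\<lambda>k. if k \<le> d then lo k else hi k) y"
proof -
  define e where "e = elast2 \<tau> \<sigma> c y"
  \<comment> \<open>n is the largest degree with n - 2 <= e. It equals \<sigma> exactly when e =
    \<sigma> - 2; the cap at \<sigma> - 1 then keeps d an admissible index, and \<open>above\<close>
    still holds at k = \<sigma>.\<close>
  define n where "n = nat \<lfloor>e + 2\<rfloor>"
  define d where "d = min (\<sigma> - 1) n"
  have e: "0 \<le> e" "real \<tau> - 2 \<le> e" "e \<le> real \<sigma> - 2"
    using elast2_bounds[OF c(1) y] by (auto simp: e_def)
  have n: "real n \<le> e + 2" "e + 2 < real n + 1"
    using e(1) unfolding n_def by linarith+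
  have "\<tau> \<le> n" using n e by linarith
  then have d: "\<tau> \<le> d" "d < \<sigma>" using \<open>\<tau> < \<sigma>\<close> by (auto simp: d_def)
  have below: "real k - 2 \<le> e" if "k \<le> d" for k
    using that n by (simp add: d_def)
  have above: "e \<le> real k - 2" if "d < k" "k \<le> \<sigma>" for k
    using that n e by (auto simp: d_def min_def not_le split: if_splits)
  define t where "t k = (if k \<le> d then lo k else hi k)" for k
  have t: "poly_coeffs \<tau> \<sigma> t"
    unfolding t_def using lohi d by (intro poly_coeffs_threshold)
  have split: "(\<Sum>k=\<tau>..\<sigma>. (real k - 2 - e) * w k)
      = (\<Sum>k=\<tau>..\<sigma>. (real k - 2) * w k) - e * (\<Sum>k=\<tau>..\<sigma>. w k)" for w
    unfolding sum_distrib_left sum_subtractf[symmetric] by (simp add: left_diff_distrib)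
  \<comment> \<open>The weighted deviations from a mean sum to 0; none of them decreases when c is
    replaced by t.\<close>
  have "0 = (\<Sum>k=\<tau>..\<sigma>. (real k - 2 - e) * weight2 c y k)"
    unfolding split using sum_weight2_pos[OF c(1) y] by (simp add: e_def elast2_def)
  also have "\<dots> \<le> (\<Sum>k=\<tau>..\<sigma>. (real k - 2 - e) * weight2 t y k)"
  proof (rule sum_mono)
    fix k assume k: "k \<in> {\<tau>..\<sigma>}"
    have "(real k - 2 - e) * c k \<le> (real k - 2 - e) * t k"
      using k c(2) below[of k] above[of k]
      by (cases "k \<le> d") (auto simp: t_def intro: mult_left_mono mult_left_mono_neg)
    moreover have "0 \<le> real k * (real k - 1) * y ^ k" using y by (cases k) auto
    ultimately have "(real k - 2 - e) * c k * (real k * (real k - 1) * y ^ k)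
        \<le> (real k - 2 - e) * t k * (real k * (real k - 1) * y ^ k)" by (rule mult_right_mono)
    then show "(real k - 2 - e) * weight2 c y k \<le> (real k - 2 - e) * weight2 t y k"
      by (simp add: weight2_def mult_ac)
  qed
  finally have "e \<le> elast2 \<tau> \<sigma> t y"
    unfolding split using sum_weight2_pos[OF t y] by (simp add: elast2_def pos_le_divide_eq)
  then show ?thesis using that[of d] d unfolding e_def t_def by auto
qed

end

section \<open>Gluing along a partition of the half-line\<close>

locale half_line_partition =
  fixes N :: nat and s :: "nat \<Rightarrow> real"
  assumes s0: "s 0 = 0" and s_Suc: "i < N \<Longrightarrow> s i < s (Suc i)"
begin

definition piece :: "nat \<Rightarrow> real set" where
  "piece i = {y. s i \<le> y \<and> (i < N \<longrightarrow> y \<le> s (Suc i))}"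

lemma s_less: "i < j \<Longrightarrow> j \<le> N \<Longrightarrow> s i < s j"
proof (induction j)
  case (Suc j)
  then show ?case using s_Suc[of j] by (cases "i = j") force+
qed simp

lemma s_le: "i \<le> j \<Longrightarrow> j \<le> N \<Longrightarrow> s i \<le> s j"
  using s_less[of i j] by (cases "i = j") auto

lemma s_nonneg: "i \<le> N \<Longrightarrow> 0 \<le> s i"
  using s_le[of 0 i] s0 by simp

lemma closed_piece: "closed (piece i)"
proof -
  have "piece i = (if i < N then {s i..s (Suc i)} else {s i..})" by (auto simp: piece_def)
  then show ?thesis by simp
qed

lemma piece_cover: "(\<Union>i\<in>{..N}. piece i) = {0..}"
proof (intro equalityI subsetI)
  fix y :: real assume "y \<in> (\<Union>i\<in>{..N}. piece i)"
  then show "y \<in> {0..}" using s_nonneg by (force simp: piece_def)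
next
  fix y :: real assume "y \<in> {0..}"
  define I where "I = {i. i \<le> N \<and> s i \<le> y}"
  have "finite I" "0 \<in> I" using \<open>y \<in> {0..}\<close> s0 by (auto simp: I_def)
  then have M: "Max I \<in> I" by (intro Max_in) auto
  have "y \<le> s (Suc (Max I))" if "Max I < N"
  proof (rule ccontr)
    assume "\<not> y \<le> s (Suc (Max I))"
    then have "Suc (Max I) \<in> I" using that by (simp add: I_def)
    then show False using Max_ge[OF \<open>finite I\<close>] by force
  qed
  then have "y \<in> piece (Max I)" "Max I \<le> N" using M by (auto simp: I_def piece_def)
  then show "y \<in> (\<Union>i\<in>{..N}. piece i)" by auto
qed

lemma piece_overlap:
  assumes "y \<in> piece i" "y \<in> piece j" "i < j" "j \<le> N"
  shows "j = Suc i" "y = s (Suc i)"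
proof -
  have le: "y \<le> s (Suc i)" "s j \<le> y" using assms by (auto simp: piece_def)
  show j: "j = Suc i" using le s_less[of "Suc i" j] assms by (cases "j = Suc i") auto
  show "y = s (Suc i)" using le j by simp
qed

lemma glue:
  assumes "\<And>i. i < N \<Longrightarrow> h i (s (Suc i)) = h (Suc i) (s (Suc i))"
  obtains H where "\<And>i y. i \<le> N \<Longrightarrow> y \<in> piece i \<Longrightarrow> H y = h i y"
proof
  fix i y assume iy: "i \<le> N" "y \<in> piece i"
  let ?j = "SOME j. j \<le> N \<and> y \<in> piece j"
  have j: "?j \<le> N" "y \<in> piece ?j" using someI[of "\<lambda>j. j \<le> N \<and> y \<in> piece j" i] iy by auto
  show "h ?j y = h i y"
  proof (cases i ?j rule: linorder_cases)
    case less
    from piece_overlap[OF iy(2) j(2) less j(1)] show ?thesis using assms[of i] less j(1) by simp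
  next
    case greater
    from piece_overlap[OF j(2) iy(2) greater iy(1)] show ?thesis using assms[of ?j] greater iy(1) by simp
  qed simp
qed

text \<open>Each h i is differentiable on the whole line, and H' is itself glued, so at a common
  endpoint both pieces yield the same one-sided derivative.\<close>

lemma glue_DERIV:
  assumes H: "\<And>i y. i \<le> N \<Longrightarrow> y \<in> piece i \<Longrightarrow> H y = h i y"
    and H': "\<And>i y. i \<le> N \<Longrightarrow> y \<in> piece i \<Longrightarrow> H' y = h' i y"
    and der: "\<And>i y. i \<le> N \<Longrightarrow> (h i has_real_derivative h' i y) (at y)"
  shows "(H has_real_derivative H' y) (at y within {0..})"
  unfolding piece_cover[symmetric]
proof (rule DERIV_within_finite_Union)
  fix i assume i: "i \<in> {..N}"
  show "(H has_real_derivative H' y) (at y within piece i)"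
  proof (cases "y \<in> piece i")
    case True
    have "(h i has_real_derivative H' y) (at y within piece i)"
      using DERIV_subset[OF der[of i y]] H'[of i y] True i by auto
    then show ?thesis
      by (rule has_field_derivative_transform_within[of _ _ _ _ 1]) (use H True i in auto)
  next
    case False
    \<comment> \<open>Outside the closed piece y is not a limit point of it, so the derivative
      statement is vacuous.\<close>
    then have "at y within piece i = bot"
      using closed_limpt[of "piece i"] closed_piece[of i] by (auto simp: trivial_limit_within)
    then show ?thesis by (simp add: has_field_derivative_iff)
  qed
qed simp

lemma glue_continuous:
  assumes "\<And>i y. i \<le> N \<Longrightarrow> y \<in> piece i \<Longrightarrow> H y = h i y"
    and "\<And>i. i \<le> N \<Longrightarrow> continuous_on UNIV (h i)"
  shows "continuous_on {0..} H"
  unfolding piece_cover[symmetric]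
proof (rule continuous_on_closed_Union)
  fix i assume i: "i \<in> {..N}"
  have "continuous_on (piece i) (h i)"
    using assms(2)[of i] i by (auto intro: continuous_on_subset)
  then show "continuous_on (piece i) H"
    using assms(1)[of i] i by (simp cong: continuous_on_cong)
qed (auto simp: closed_piece)

end

lemma finite_set_partition:
  fixes S :: "real set"
  assumes "finite S" "S \<subseteq> {0<..}"
  obtains N s where "half_line_partition N s" "s ` {1..N} = S"
proof
  define xs where "xs = sorted_list_of_set S"
  define s where "s i = (if i = 0 then 0 else xs ! (i - 1))" for i
  have xs: "set xs = S" "sorted_wrt (<) xs" using assms by (auto simp: xs_def)
  show "half_line_partition (length xs) s"
  proof
    fix i assume i: "i < length xs"
    show "s i < s (Suc i)"
    proof (cases i)
      case 0
      then show ?thesis using i xs(1) assms(2) nth_mem[of 0 xs] by (auto simp: s_def)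
    next
      case (Suc j)
      then show ?thesis using i sorted_wrt_nth_less[OF xs(2), of j i] by (simp add: s_def)
    qed
  qed (simp add: s_def)
  have "s ` {1..length xs} = (\<lambda>i. xs ! i) ` {..<length xs}"
  proof -
    have "s ` {1..length xs} = s ` Suc ` {..<length xs}" by (simp add: image_Suc_lessThan)
    then show ?thesis unfolding image_image by (simp add: s_def)
  qed
  then show "s ` {1..length xs} = S" using xs(1) by (auto simp: set_conv_nth image_def)
qed

lemma safe_envelopeE:
  assumes "safe_envelope J g fhat"
  obtains N s \<kappa> C a b where
    "\<forall>i\<le>N. \<forall>y. s i \<le> y \<and> (i < N \<longrightarrow> y \<le> s (Suc i)) \<longrightarrow> fhat y = envelope_piece g \<kappa> C a b i y"
    "s 0 = 0" "\<forall>i<N. s i < s (Suc i)"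
    "\<forall>i\<le>N. \<forall>y. s i < y \<and> (i < N \<longrightarrow> y < s (Suc i)) \<longrightarrow> safe_selection J g y = \<kappa> i"
    "\<forall>i\<le>N. 0 < C i" "C 0 = 1" "a 0 = 0" "b 0 = 0"
    "\<forall>i<N. \<forall>r\<le>2. (cost_deriv ^^ r) (envelope_piece g \<kappa> C a b i) (s (Suc i)) =
      (cost_deriv ^^ r) (envelope_piece g \<kappa> C a b (Suc i)) (s (Suc i))"
  using assms unfolding safe_envelope_def by (elim conjE exE) (rule that; assumption)

section \<open>The safe selection\<close>

lemma poly_nonpos_eventually_const:
  fixes p :: "real poly"
  assumes "p = 0 \<or> poly p y \<noteq> 0"
  shows "\<forall>\<^sub>F z in at y. poly p z \<le> 0 \<longleftrightarrow> poly p y \<le> 0"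
proof (cases "p = 0")
  case False
  have lim: "(poly p \<longlongrightarrow> poly p y) (at y)" by (rule tendsto_poly[OF tendsto_ident_at])
  consider "poly p y < 0" | "poly p y > 0" using False assms by fastforce
  then show ?thesis
  proof cases
    case 1
    then show ?thesis using order_tendstoD(2)[OF lim 1] by (auto elim: eventually_mono)
  next
    case 2
    then show ?thesis using order_tendstoD(1)[OF lim 2] by (auto elim: eventually_mono)
  qed
qed simp

locale coeff_bounds = cost_bounds +
  fixes lo hi :: "nat \<Rightarrow> real"
  assumes lohi: "\<forall>k\<in>{\<tau>..\<sigma>}. 0 \<le> lo k \<and> lo k \<le> hi k" "0 < lo \<tau>" "0 < lo \<sigma>"
    and tau_less: "\<tau> < \<sigma>"
begin

abbreviation "thr \<equiv> \<lambda>d k. if k \<le> d then lo k else hi k"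
abbreviation "J \<equiv> {\<tau>..<\<sigma>}"
abbreviation "g \<equiv> threshold_cost \<tau> \<sigma> lo hi"
abbreviation "Q d \<equiv> cost_poly \<tau> \<sigma> (thr d)"
abbreviation "El d \<equiv> elast2 \<tau> \<sigma> (thr d)"
abbreviation "sel \<equiv> safe_selection J g"

lemma thr_coeffs: "d \<in> J \<Longrightarrow> poly_coeffs \<tau> \<sigma> (thr d)"
  using poly_coeffs_threshold[OF lohi] by auto

lemma g_eq: "g d y = poly (Q d) y"
  by (simp add: threshold_cost_def poly_cost_poly)

lemma elasticity_g: "d \<in> J \<Longrightarrow> 0 < y \<Longrightarrow> elasticity (cost_deriv (cost_deriv (g d))) y = El d y"
  unfolding threshold_cost_def by (rule elasticity_poly_cost[OF thr_coeffs])

lemma sel_eq: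
  assumes "0 < y"
  shows "sel y = (LEAST k. k \<in> J \<and> (\<forall>l\<in>J. El l y \<le> El k y))"
  unfolding safe_selection_def
  by (rule arg_cong[where f = Least]) (auto simp: elasticity_g[OF _ assms] fun_eq_iff)

lemma sel_max:
  assumes "0 < y"
  shows "sel y \<in> J" "l \<in> J \<Longrightarrow> El l y \<le> El (sel y) y"
proof -
  have "finite ((\<lambda>d. El d y) ` J)" "(\<lambda>d. El d y) ` J \<noteq> {}" using tau_less by auto
  from Max_in[OF this] obtain k where k: "k \<in> J" "Max ((\<lambda>d. El d y) ` J) = El k y"
    unfolding image_iff by blast
  have "k \<in> J \<and> (\<forall>l\<in>J. El l y \<le> El k y)"
    unfolding k(2)[symmetric] using k(1) by (auto intro!: Max_ge)
  from LeastI[of "\<lambda>k. k \<in> J \<and> (\<forall>l\<in>J. El l y \<le> El k y)", OF this]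
  show "sel y \<in> J" "l \<in> J \<Longrightarrow> El l y \<le> El (sel y) y" unfolding sel_eq[OF assms] by auto
qed

text \<open>Up to the positive product of the two second derivatives this is
  \<open>El k - El l\<close>, so comparing elasticities becomes a question about the sign of a
  polynomial.\<close>

definition diff_poly :: "nat \<Rightarrow> nat \<Rightarrow> real poly" where
  "diff_poly k l = [:0, 1:] * ((pderiv ^^ 3) (Q k) * (pderiv ^^ 2) (Q l)
                              - (pderiv ^^ 3) (Q l) * (pderiv ^^ 2) (Q k))"

lemma El_le_iff:
  assumes "k \<in> J" "l \<in> J" "0 < y"
  shows "El k y \<le> El l y \<longleftrightarrow> poly (diff_poly k l) y \<le> 0"
proof -
  let ?k = "poly ((pderiv ^^ 2) (Q k)) y" and ?l = "poly ((pderiv ^^ 2) (Q l)) y"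
  have pos: "0 < ?k" "0 < ?l" using pderiv2_pos[OF thr_coeffs] assms by auto
  have "poly (diff_poly k l) y = (y * poly ((pderiv ^^ 3) (Q k)) y) * ?l
      - (y * poly ((pderiv ^^ 3) (Q l)) y) * ?k"
    by (simp add: diff_poly_def algebra_simps)
  also have "\<dots> = (El k y - El l y) * (?k * ?l)"
    unfolding pderiv3_elast2[OF thr_coeffs[OF assms(1)] assms(3)]
      pderiv3_elast2[OF thr_coeffs[OF assms(2)] assms(3)] by (simp add: algebra_simps)
  finally show ?thesis using pos by (simp add: mult_le_0_iff)
qed

text \<open>Away from the roots of the nonzero polynomials \<open>diff_poly k l\<close> no
  comparison between two elasticities changes, hence neither does the least maximizer. Pairs with
  \<open>diff_poly k l = 0\<close> have equal elasticities throughout.\<close>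

lemma finite_switching_points: "finite (switching_points J g)"
proof (rule finite_subset)
  let ?Z = "\<Union>k\<in>J. \<Union>l\<in>J. if diff_poly k l = 0 then {} else {y. poly (diff_poly k l) y = 0}"
  show "finite ?Z" by (auto simp: poly_roots_finite)
  show "switching_points J g \<subseteq> ?Z"
  proof (rule subsetI, rule ccontr)
    fix y assume y: "y \<in> switching_points J g" "y \<notin> ?Z"
    then have "0 < y" by (simp add: switching_points_def)
    have "\<forall>\<^sub>F z in at y. \<forall>k\<in>J. \<forall>l\<in>J. poly (diff_poly k l) z \<le> 0 \<longleftrightarrow> poly (diff_poly k l) y \<le> 0"
      using y(2) by (intro eventually_ball_finite ballI poly_nonpos_eventually_const) (auto split: if_splits)
    moreover have "\<forall>\<^sub>F z in at y. 0 < z"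
      using order_tendstoD(1)[OF tendsto_ident_at \<open>0 < y\<close>] .
    ultimately have "\<forall>\<^sub>F z in at y. sel z = sel y"
    proof eventually_elim
      case (elim z)
      have "(\<forall>l\<in>J. El l z \<le> El k z) \<longleftrightarrow> (\<forall>l\<in>J. El l y \<le> El k y)" if "k \<in> J" for k
        using El_le_iff[OF _ that] elim \<open>0 < y\<close> that by auto
      then show ?case unfolding sel_eq[OF elim(2)] sel_eq[OF \<open>0 < y\<close>]
        by (intro arg_cong[where f = Least] ext conj_cong refl) auto
    qed
    then show False using y(1) by (simp add: switching_points_def)
  qed
qed

lemma El_continuous:
  assumes "d \<in> J"
  shows "continuous_on {0<..} (El d)"
proof -
  have "continuous_on {0<..} (\<lambda>y. (\<Sum>k=\<tau>..\<sigma>. (real k - 2) * weight2 (thr d) y k) / (\<Sum>k=\<tau>..\<sigma>. weight2 (thr d) y k))"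
  proof (rule continuous_on_divide)
    show "\<forall>y\<in>{0<..}. (\<Sum>k=\<tau>..\<sigma>. weight2 (thr d) y k) \<noteq> 0"
      using sum_weight2_pos[OF thr_coeffs[OF assms]] by (metis greaterThan_iff less_irrefl)
  qed (unfold weight2_def, (intro continuous_intros)+)
  then show ?thesis by (simp add: elast2_def[abs_def])
qed

definition piece_poly ::
    "(nat \<Rightarrow> nat) \<Rightarrow> (nat \<Rightarrow> real) \<Rightarrow> (nat \<Rightarrow> real) \<Rightarrow> (nat \<Rightarrow> real) \<Rightarrow> nat \<Rightarrow> real poly" where
  "piece_poly \<kappa> C a b i = smult (C i) (Q (\<kappa> i)) + [:b i, a i:]"

lemma funpow_cost_deriv_piece:
  assumes "0 \<le> y"
  shows "(cost_deriv ^^ r) (envelope_piece g \<kappa> C a b i) y = poly ((pderiv ^^ r) (piece_poly \<kappa> C a b i)) y"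
  by (rule funpow_cost_deriv_poly) (use assms in \<open>auto simp: envelope_piece_def piece_poly_def g_eq\<close>)

lemma pderiv_piece_poly:
  "pderiv (piece_poly \<kappa> C a b i) = smult (C i) (pderiv (Q (\<kappa> i))) + [:a i:]"
  "(pderiv ^^ 2) (piece_poly \<kappa> C a b i) = smult (C i) ((pderiv ^^ 2) (Q (\<kappa> i)))"
  "(pderiv ^^ 3) (piece_poly \<kappa> C a b i) = smult (C i) ((pderiv ^^ 3) (Q (\<kappa> i)))"
  by (simp_all add: piece_poly_def pderiv2_eq pderiv3_eq pderiv_add pderiv_smult pderiv_pCons)

text \<open>The interior of a piece is connected and free of switching points, so the locally
  constant selection is constant on it.\<close>

lemma selection_const:
  assumes "half_line_partition N s" and sw: "s ` {1..N} = switching_points J g" and "i \<le> N"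
  obtains k where "k \<in> J" "\<forall>y. s i < y \<and> (i < N \<longrightarrow> y < s (Suc i)) \<longrightarrow> sel y = k"
proof -
  interpret half_line_partition N s by fact
  define A where "A = (if i < N then {s i<..<s (Suc i)} else {s i<..})"
  have "connected A" by (auto simp: A_def)
  have pos: "0 < y" if "y \<in> A" for y
    using that s_nonneg[OF \<open>i \<le> N\<close>] by (auto simp: A_def split: if_splits)
  have "open A" by (auto simp: A_def)
  have no: "y \<notin> switching_points J g" if "y \<in> A" for y
  proof
    assume "y \<in> switching_points J g"
    then obtain j where j: "y = s j" "1 \<le> j" "j \<le> N" using sw by force
    show False
      using that j s_le[of j i] s_le[of "Suc i" j] \<open>i \<le> N\<close>
      by (cases "j \<le> i") (auto simp: A_def split: if_splits)
  qed
  have loc: "\<forall>x\<in>A. \<forall>\<^sub>F z in at x within A. sel x = sel z"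
  proof
    fix x assume "x \<in> A"
    then have "\<forall>\<^sub>F z in at x. sel z = sel x" using no[of x] pos[of x] by (auto simp: switching_points_def)
    then show "\<forall>\<^sub>F z in at x within A. sel x = sel z"
      using at_within_open[OF \<open>x \<in> A\<close> \<open>open A\<close>] by (auto elim: eventually_mono)
  qed
  have "A \<noteq> {}" using s_Suc[of i] gt_ex[of "s i"] by (auto simp: A_def)
  then obtain m where m: "m \<in> A" by blast
  show ?thesis
  proof (rule that[of "sel m"])
    show "sel m \<in> J" by (rule sel_max(1)[OF pos[OF m]])
    have "sel y = sel m" if "y \<in> A" for y
      using connected_local_const[OF \<open>connected A\<close> that m loc] .
    then show "\<forall>y. s i < y \<and> (i < N \<longrightarrow> y < s (Suc i)) \<longrightarrow> sel y = sel m"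
      by (auto simp: A_def)
  qed
qed

lemma safe_envelope_exists: "\<exists>fhat. safe_envelope J g fhat"
proof -
  have "switching_points J g \<subseteq> {0<..}" by (auto simp: switching_points_def)
  then obtain N s where part: "half_line_partition N s" and sw: "s ` {1..N} = switching_points J g"
    by (rule finite_set_partition[OF finite_switching_points])
  interpret half_line_partition N s by fact
  have "\<exists>k. i \<le> N \<longrightarrow> k \<in> J \<and> (\<forall>y. s i < y \<and> (i < N \<longrightarrow> y < s (Suc i)) \<longrightarrow> sel y = k)" for i
  proof (cases "i \<le> N")
    case True
    obtain k where "k \<in> J" "\<forall>y. s i < y \<and> (i < N \<longrightarrow> y < s (Suc i)) \<longrightarrow> sel y = k"
      by (rule selection_const[OF part sw True])
    then show ?thesis by (intro exI[of _ k]) simp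
  qed simp
  then have "\<exists>\<kappa>. \<forall>i. i \<le> N \<longrightarrow> \<kappa> i \<in> J \<and> (\<forall>y. s i < y \<and> (i < N \<longrightarrow> y < s (Suc i)) \<longrightarrow> sel y = \<kappa> i)"
    by (intro choice allI)
  then obtain \<kappa> where \<kappa>': "\<forall>i. i \<le> N \<longrightarrow> \<kappa> i \<in> J \<and> (\<forall>y. s i < y \<and> (i < N \<longrightarrow> y < s (Suc i)) \<longrightarrow> sel y = \<kappa> i)" ..
  have \<kappa>: "i \<le> N \<Longrightarrow> \<kappa> i \<in> J"
    "i \<le> N \<Longrightarrow> s i < y \<Longrightarrow> (i < N \<longrightarrow> y < s (Suc i)) \<Longrightarrow> sel y = \<kappa> i" for i y
    using \<kappa>' by simp_all
  \<comment> \<open>\<open>q r k i\<close> is the r-th derivative of the cost selected on piece k,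
    taken at the right end of piece i.\<close>
  define q where "q r k i = poly ((pderiv ^^ r) (Q (\<kappa> k))) (s (Suc i))" for r k i
  have qpos: "0 < q 2 i i" "0 < q 2 (Suc i) i" if "i < N" for i
    using pderiv2_pos[OF thr_coeffs[OF \<kappa>(1)]] s_nonneg[of i] s_Suc[OF that] that by (auto simp: q_def)
  \<comment> \<open>The matching conditions are triangular: the second derivatives determine C, as
    the affine part disappears; then the slopes determine a, and then the values determine
    b.\<close>
  define C where "C = rec_nat 1 (\<lambda>i c. c * q 2 i i / q 2 (Suc i) i)"
  define a where "a = rec_nat 0 (\<lambda>i x. x + C i * q 1 i i - C (Suc i) * q 1 (Suc i) i)"
  define b where "b = rec_nat 0 (\<lambda>i x. x + C i * q 0 i i - C (Suc i) * q 0 (Suc i) i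
      + (a i - a (Suc i)) * s (Suc i))"
  have C: "C 0 = 1" "C (Suc i) = C i * q 2 i i / q 2 (Suc i) i" for i by (auto simp: C_def)
  have a: "a 0 = 0" "a (Suc i) = a i + C i * q 1 i i - C (Suc i) * q 1 (Suc i) i" for i
    by (auto simp: a_def)
  have b: "b 0 = 0" "b (Suc i) = b i + C i * q 0 i i - C (Suc i) * q 0 (Suc i) i
      + (a i - a (Suc i)) * s (Suc i)" for i
    by (auto simp: b_def)
  have Cpos: "i \<le> N \<Longrightarrow> 0 < C i" for i
    by (induction i) (auto simp: C qpos)
  have match: "(cost_deriv ^^ r) (envelope_piece g \<kappa> C a b i) (s (Suc i)) =
      (cost_deriv ^^ r) (envelope_piece g \<kappa> C a b (Suc i)) (s (Suc i))" if "i < N" "r \<le> 2" for i r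
  proof -
    have "0 \<le> s (Suc i)" using s_nonneg[of "Suc i"] that by simp
    moreover consider "r = 0" | "r = 1" | "r = 2" using \<open>r \<le> 2\<close> by linarith
    then have "poly ((pderiv ^^ r) (piece_poly \<kappa> C a b i)) (s (Suc i))
        = poly ((pderiv ^^ r) (piece_poly \<kappa> C a b (Suc i))) (s (Suc i))"
    proof cases
      case 1
      then show ?thesis by (simp add: piece_poly_def b q_def algebra_simps)
    next
      case 2
      then show ?thesis by (simp add: pderiv_piece_poly a q_def algebra_simps)
    next
      case 3
      then have "C i * q 2 i i = C (Suc i) * q 2 (Suc i) i" using qpos(2)[OF \<open>i < N\<close>] by (simp add: C)
      with 3 show ?thesis by (simp add: pderiv_piece_poly q_def)
    qed
    ultimately show ?thesis by (simp add: funpow_cost_deriv_piece)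
  qed
  obtain fhat where "\<And>i y. i \<le> N \<Longrightarrow> y \<in> piece i \<Longrightarrow> fhat y = envelope_piece g \<kappa> C a b i y"
    using glue[of "envelope_piece g \<kappa> C a b"] match[of _ 0] by auto
  then have fhat: "\<forall>i\<le>N. \<forall>y. s i \<le> y \<and> (i < N \<longrightarrow> y \<le> s (Suc i)) \<longrightarrow> fhat y = envelope_piece g \<kappa> C a b i y"
    by (simp add: piece_def)
  have props: "finite J" "J \<noteq> {}" "\<forall>i<N. s i < s (Suc i)"
    "\<forall>i\<le>N. \<forall>y. s i < y \<and> (i < N \<longrightarrow> y < s (Suc i)) \<longrightarrow> sel y = \<kappa> i" "\<forall>i\<le>N. 0 < C i"
    "\<forall>i<N. \<forall>r\<le>2. (cost_deriv ^^ r) (envelope_piece g \<kappa> C a b i) (s (Suc i)) =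
      (cost_deriv ^^ r) (envelope_piece g \<kappa> C a b (Suc i)) (s (Suc i))"
    using tau_less s_Suc \<kappa>(2) Cpos match by simp_all
  have "safe_envelope J g fhat"
    unfolding safe_envelope_def
    by (intro conjI exI[of _ N] exI[of _ s] exI[of _ \<kappa>] exI[of _ C] exI[of _ a] exI[of _ b];
        fact props s0 sw C(1) a(1) b(1) fhat)
  then show ?thesis by (rule exI[of _ fhat])
qed

section \<open>Regularity of the safe envelope\<close>

definition max_elast :: "real \<Rightarrow> real" where
  "max_elast y = El (sel y) y"

lemma max_elast_upper: "0 < y \<Longrightarrow> l \<in> J \<Longrightarrow> El l y \<le> max_elast y"
  unfolding max_elast_def by (rule sel_max)

lemma max_elast_mono: "0 < y \<Longrightarrow> y \<le> z \<Longrightarrow> max_elast y \<le> max_elast z"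
  using elast2_mono[OF thr_coeffs[OF sel_max(1)], of y y z] max_elast_upper[of z "sel y"] sel_max(1)[of y]
  by (simp add: max_elast_def)

lemma max_elast_bounds:
  assumes "0 < y"
  shows "0 \<le> max_elast y" "real \<tau> - 2 \<le> max_elast y" "max_elast y \<le> real \<sigma> - 2"
  using elast2_bounds[OF thr_coeffs[OF sel_max(1)[OF assms]] assms] by (auto simp: max_elast_def)

lemma elast2_le_max_elast:
  assumes "poly_coeffs \<tau> \<sigma> c" "\<forall>k\<in>{\<tau>..\<sigma>}. lo k \<le> c k \<and> c k \<le> hi k" "0 < y"
  shows "elast2 \<tau> \<sigma> c y \<le> max_elast y"
proof -
  obtain d where "d \<in> J" "elast2 \<tau> \<sigma> c y \<le> El d y"
    using elast2_le_threshold[OF lohi tau_less assms] by blast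
  then show ?thesis using max_elast_upper[OF assms(3)] by force
qed

text \<open>The third derivatives also match at a switching point, because both adjacent indices attain
  the maximal elasticity there.\<close>
lemma safe_envelope_derivs:
  assumes "safe_envelope J g fhat"
  obtains D d r where "\<And>y. 0 \<le> y \<Longrightarrow> fhat y = D 0 y"
    "\<And>j y. j < 3 \<Longrightarrow> 0 \<le> y \<Longrightarrow> (D j has_real_derivative D (Suc j) y) (at y within {0..})"
    "continuous_on {0..} (D 3)"
    "\<And>y. 0 < y \<Longrightarrow> 0 < D 2 y"
    "\<And>y. 0 < y \<Longrightarrow> y * D 3 y = max_elast y * D 2 y"
    "d \<in> J" "D 1 0 = poly (pderiv (Q d)) 0" "0 < r" "\<And>y. 0 \<le> y \<Longrightarrow> y < r \<Longrightarrow> fhat y = poly (Q d) y"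
proof -
  obtain N s \<kappa> C a b where
    fhat: "\<forall>i\<le>N. \<forall>y. s i \<le> y \<and> (i < N \<longrightarrow> y \<le> s (Suc i)) \<longrightarrow> fhat y = envelope_piece g \<kappa> C a b i y"
    and s: "s 0 = 0" "\<forall>i<N. s i < s (Suc i)"
    and \<kappa>: "\<forall>i\<le>N. \<forall>y. s i < y \<and> (i < N \<longrightarrow> y < s (Suc i)) \<longrightarrow> sel y = \<kappa> i"
    and C: "\<forall>i\<le>N. 0 < C i" and init: "C 0 = 1" "a 0 = 0" "b 0 = 0"
    and match: "\<forall>i<N. \<forall>r\<le>2. (cost_deriv ^^ r) (envelope_piece g \<kappa> C a b i) (s (Suc i)) =
                       (cost_deriv ^^ r) (envelope_piece g \<kappa> C a b (Suc i)) (s (Suc i))"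
    by (rule safe_envelopeE[OF assms])
  interpret half_line_partition N s using s by unfold_locales auto
  define h where "h r i = poly ((pderiv ^^ r) (piece_poly \<kappa> C a b i))" for r i
  have \<kappa>J: "\<kappa> i \<in> J" and \<kappa>max: "\<And>y l. 0 < y \<Longrightarrow> y \<in> piece i \<Longrightarrow> l \<in> J \<Longrightarrow> El l y \<le> El (\<kappa> i) y"
    if "i \<le> N" for i
  proof -
    define A where "A = (if i < N then {s i<..<s (Suc i)} else {s i<..})"
    have A: "sel y = \<kappa> i" "0 < y" if "y \<in> A" for y
      using \<kappa> that \<open>i \<le> N\<close> s_nonneg[OF \<open>i \<le> N\<close>] by (auto simp: A_def split: if_splits)
    have "A \<noteq> {}" using s_Suc[of i] gt_ex[of "s i"] by (auto simp: A_def)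
    then obtain m where m: "m \<in> A" by blast
    show "\<kappa> i \<in> J" using sel_max(1)[OF A(2)[OF m]] A(1)[OF m] by simp
    fix y l assume y: "0 < y" "y \<in> piece i" and l: "l \<in> J"
    have AE: "El l x \<le> El (\<kappa> i) x" if "x \<in> A" for x
      using sel_max(2)[OF A(2)[OF that] l] A(1)[OF that] by simp
    have "A \<subseteq> piece i" by (auto simp: A_def piece_def)
    have "closure A = piece i"
      using s_Suc[of i] by (auto simp: A_def piece_def)
    \<comment> \<open>The inequality passes from the open piece to its ends by continuity. The cut
      at y / 2 stays away from 0, where \<open>elast2\<close> is 0 / 0.\<close>
    have "closed {x \<in> piece i \<inter> {y/2..}. El l x \<le> El (\<kappa> i) x}"
      by (intro continuous_on_closed_Collect_le continuous_on_subset[OF El_continuous])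
        (use l y \<open>\<kappa> i \<in> J\<close> closed_piece in auto)
    moreover have "A \<inter> {y/2<..} \<subseteq> {x \<in> piece i \<inter> {y/2..}. El l x \<le> El (\<kappa> i) x}"
      using AE \<open>A \<subseteq> piece i\<close> by auto
    ultimately have "closure (A \<inter> {y/2<..}) \<subseteq> {x \<in> piece i \<inter> {y/2..}. El l x \<le> El (\<kappa> i) x}"
      by (rule closure_minimal[rotated])
    moreover have "y \<in> closure (A \<inter> {y/2<..})"
      using open_Int_closure_subset[of "{y/2<..}" A] y \<open>closure A = piece i\<close> by (auto simp: Int_commute)
    ultimately show "El l y \<le> El (\<kappa> i) y" by auto
  qed
  have max_eq: "El (\<kappa> i) y = max_elast y" if "i \<le> N" "0 < y" "y \<in> piece i" for i y
    using \<kappa>max[OF that(1,2,3) sel_max(1)[OF that(2)]] max_elast_upper[OF that(2) \<kappa>J[OF that(1)]]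
    by (simp add: max_elast_def)
  have h2: "0 < h 2 i y" if "i \<le> N" "0 < y" for i y
    using C pderiv2_pos[OF thr_coeffs[OF \<kappa>J[OF that(1)]] that(2)] that by (simp add: h_def pderiv_piece_poly)
  have h3: "y * h 3 i y = max_elast y * h 2 i y" if "i \<le> N" "0 < y" "y \<in> piece i" for i y
    using pderiv3_elast2[OF thr_coeffs[OF \<kappa>J[OF that(1)]] that(2)] max_eq[OF that]
    by (simp add: h_def pderiv_piece_poly)
  have hmatch: "h r i (s (Suc i)) = h r (Suc i) (s (Suc i))" if "i < N" "r \<le> 3" for i r
  proof -
    have spos: "0 < s (Suc i)" using s_nonneg[of i] s_Suc that by force
    have low: "h r i (s (Suc i)) = h r (Suc i) (s (Suc i))" if "r \<le> 2" for r
      using match[rule_format, OF \<open>i < N\<close> that] spos by (simp add: funpow_cost_deriv_piece h_def)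
    have "s (Suc i) \<in> piece i" "s (Suc i) \<in> piece (Suc i)"
      using s_Suc[of i] s_Suc[of "Suc i"] \<open>i < N\<close> by (auto simp: piece_def)
    then have "s (Suc i) * h 3 i (s (Suc i)) = s (Suc i) * h 3 (Suc i) (s (Suc i))"
      using h3[of i "s (Suc i)"] h3[of "Suc i" "s (Suc i)"] low[of 2] spos \<open>i < N\<close> by simp
    then have "h 3 i (s (Suc i)) = h 3 (Suc i) (s (Suc i))" using spos by simp
    then show ?thesis using low[of r] \<open>r \<le> 3\<close> by (cases "r = 3") auto
  qed
  have "\<exists>H. r \<le> 3 \<longrightarrow> (\<forall>i y. i \<le> N \<longrightarrow> y \<in> piece i \<longrightarrow> H y = h r i y)" for r
    using glue[of "h r"] hmatch[of _ r] by metis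
  then obtain D where D: "r \<le> 3 \<Longrightarrow> i \<le> N \<Longrightarrow> y \<in> piece i \<Longrightarrow> D r y = h r i y" for r i y
    by metis
  have cover: "\<exists>i\<le>N. y \<in> piece i" if "0 \<le> y" for y
    using piece_cover that by auto
  \<comment> \<open>[0, r) lies in the first piece; 1 is an arbitrary choice when there is no
    switching point.\<close>
  define r where "r = (if N = 0 then 1 else s 1)"
  have r: "0 < r" using s(1) s_Suc[of 0] by (auto simp: r_def)
  have p0: "y \<in> piece 0" if "0 \<le> y" "y < r" for y
    using that s(1) by (auto simp: piece_def r_def)
  show ?thesis
  proof
    fix y :: real assume "0 \<le> y"
    then obtain i where "i \<le> N" "y \<in> piece i" using cover by blast
    then show "fhat y = D 0 y"
      using D[of 0 i y] fhat by (simp add: piece_def h_def piece_poly_def envelope_piece_def g_eq)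
  next
    fix j :: nat and y :: real assume j: "j < 3"
    show "(D j has_real_derivative D (Suc j) y) (at y within {0..})"
      by (rule glue_DERIV[where h = "h j" and h' = "h (Suc j)"]) (use D j in \<open>auto simp: h_def\<close>)
  next
    show "continuous_on {0..} (D 3)"
      by (rule glue_continuous[where h = "h 3"]) (use D in \<open>auto simp: h_def intro!: continuous_intros\<close>)
  next
    fix y :: real assume y: "0 < y"
    then obtain i where "i \<le> N" "y \<in> piece i" using cover[of y] by auto
    then show "0 < D 2 y" "y * D 3 y = max_elast y * D 2 y"
      using D[of _ i y] h2[of i y] h3[of i y] y by auto
  next
    show "\<kappa> 0 \<in> J" by (rule \<kappa>J) simp
    show "D 1 0 = poly (pderiv (Q (\<kappa> 0))) 0"
      using D[of 1 0 0] p0[of 0] r init by (simp add: h_def pderiv_piece_poly)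
    show "0 < r" by fact
    fix y :: real assume "0 \<le> y" "y < r"
    then show "fhat y = poly (Q (\<kappa> 0)) y"
      using fhat[rule_format, of 0 y] p0[of y] init by (auto simp: piece_def envelope_piece_def g_eq)
  qed
qed

end

lemma coeff_cost_poly: "coeff (cost_poly \<tau> \<sigma> c) k = (if k \<in> {\<tau>..\<sigma>} then c k else 0)"
  by (simp add: cost_poly_def coeff_sum)

lemma poly_analytic_at_origin:
  assumes "0 < r" "\<And>y. 0 \<le> y \<Longrightarrow> y < r \<Longrightarrow> f y = poly p y"
  shows "analytic_at_origin f"
  unfolding analytic_at_origin_def
proof (intro exI[of _ "coeff p"] exI[of _ r] conjI ballI)
  fix y assume "y \<in> {0..<r}"
  moreover have "(\<lambda>n. coeff p n * y ^ n) sums (\<Sum>n\<le>degree p. coeff p n * y ^ n)"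
    by (rule sums_finite) (auto simp: coeff_eq_0)
  ultimately show "(\<lambda>n. coeff p n * y ^ n) sums f y"
    using assms(2)[of y] by (simp add: poly_altdef)
qed fact

text \<open>The tangent at the intermediate point w lies strictly below f at both ends; averaging
  the two inequalities gives the claim.\<close>

lemma strictly_convex_onI:
  assumes der: "\<And>y. 0 \<le> y \<Longrightarrow> (f has_real_derivative f' y) (at y within {0..})"
    and mono: "\<And>x y. 0 \<le> x \<Longrightarrow> x < y \<Longrightarrow> f' x < f' y"
  shows "strictly_convex_on {0..} f"
proof -
  have main: "f (u * x + (1 - u) * y) < u * f x + (1 - u) * f y"
    if xy: "0 \<le> x" "x < y" and u: "0 < u" "u < 1" for x y u
  proof -
    define w where "w = u * x + (1 - u) * y"
    have wx: "w - x = (1 - u) * (y - x)" and yw: "y - w = u * (y - x)"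
      by (auto simp: w_def algebra_simps)
    have "0 < w - x" "0 < y - w" unfolding wx yw using xy u by simp_all
    then have w: "0 \<le> x" "x < w" "w < y" "0 \<le> w" using xy by auto
    have 1: "f w - f' w * w < f x - f' w * x"
    proof -
      have "(\<lambda>t. f' w * t - f t) x < (\<lambda>t. f' w * t - f t) w"
        by (rule increasing_within_half_line[where f' = "\<lambda>t. f' w - f' t"])
          (use w mono in \<open>auto intro!: derivative_eq_intros der\<close>)
      then show ?thesis by simp
    qed
    have 2: "f w - f' w * w < f y - f' w * y"
    proof -
      have "(\<lambda>t. f t - f' w * t) w < (\<lambda>t. f t - f' w * t) y"
        by (rule increasing_within_half_line[where f' = "\<lambda>t. f' t - f' w"])
          (use w mono in \<open>auto intro!: derivative_eq_intros der\<close>)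
      then show ?thesis by simp
    qed
    have "u * (f w - f' w * w) + (1 - u) * (f w - f' w * w)
        < u * (f x - f' w * x) + (1 - u) * (f y - f' w * y)"
      using u 1 2 by (intro add_strict_mono mult_strict_left_mono) auto
    also have "\<dots> = u * f x + (1 - u) * f y - f' w * w"
      by (simp add: w_def algebra_simps)
    finally show ?thesis unfolding w_def[symmetric] by (simp add: algebra_simps)
  qed
  show ?thesis
    unfolding strictly_convex_on_def
  proof (intro conjI ballI allI impI)
    fix x y u :: real assume a: "x \<in> {0..}" "y \<in> {0..}" "x \<noteq> y \<and> 0 < u \<and> u < 1"
    show "f (u * x + (1 - u) * y) < u * f x + (1 - u) * f y"
    proof (cases "x < y")
      case True
      then show ?thesis using a main[of x y u] by simp
    next
      case False
      then show ?thesis using a main[of y x "1 - u"] by (simp add: add.commute)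
    qed
  qed simp
qed

context coeff_bounds
begin

lemma safe_envelope_cost_derivs:
  assumes "safe_envelope J g fhat"
  shows "0 \<le> y \<Longrightarrow> (fhat has_real_derivative cost_deriv fhat y) (at y within {0..})"
    and "0 \<le> y \<Longrightarrow> (cost_deriv fhat has_real_derivative cost_deriv (cost_deriv fhat) y) (at y within {0..})"
    and "0 \<le> y \<Longrightarrow> (cost_deriv (cost_deriv fhat) has_real_derivative
           cost_deriv (cost_deriv (cost_deriv fhat)) y) (at y within {0..})"
    and "continuous_on {0..} (cost_deriv (cost_deriv (cost_deriv fhat)))"
    and "0 < y \<Longrightarrow> 0 < cost_deriv (cost_deriv fhat) y"
    and "0 < y \<Longrightarrow> y * cost_deriv (cost_deriv (cost_deriv fhat)) y = max_elast y * cost_deriv (cost_deriv fhat) y"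
    and "\<exists>d\<in>J. \<exists>r>0. cost_deriv fhat 0 = poly (pderiv (Q d)) 0 \<and> (\<forall>y. 0 \<le> y \<and> y < r \<longrightarrow> fhat y = poly (Q d) y)"
proof (atomize (full), rule safe_envelope_derivs[OF assms], goal_cases)
  case (1 D d r)
  note D = this
  have cd: "(cost_deriv ^^ j) fhat y = D j y" if "j \<le> 3" "0 \<le> y" for j y
    by (rule funpow_cost_deriv_eq[where h = D and n = 3]) (use D(1,2) that in auto)
  have cd1: "cost_deriv fhat y = D 1 y" and cd2: "cost_deriv (cost_deriv fhat) y = D 2 y"
    and cd3: "cost_deriv (cost_deriv (cost_deriv fhat)) y = D 3 y" if "0 \<le> y" for y
    using cd[of 1 y] cd[of 2 y] cd[of 3 y] that by (simp_all add: numeral_2_eq_2 numeral_3_eq_3)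
  have der: "(fhat has_real_derivative D 1 y) (at y within {0..})"
    "(cost_deriv fhat has_real_derivative D 2 y) (at y within {0..})"
    "(cost_deriv (cost_deriv fhat) has_real_derivative D 3 y) (at y within {0..})" if y: "0 \<le> y"
    using has_real_derivative_cong_half_line[OF D(2)[of 0 y] y, of fhat] D(1)
      has_real_derivative_cong_half_line[OF D(2)[of 1 y] y, of "cost_deriv fhat"] cd1
      has_real_derivative_cong_half_line[OF D(2)[of 2 y] y, of "cost_deriv (cost_deriv fhat)"] cd2 y
    by (simp_all add: numeral_2_eq_2 numeral_3_eq_3)
  have "continuous_on {0..} (cost_deriv (cost_deriv (cost_deriv fhat)))"
    by (rule continuous_on_eq[OF D(3)]) (simp add: cd3)
  moreover have "\<exists>d\<in>J. \<exists>r>0. cost_deriv fhat 0 = poly (pderiv (Q d)) 0 \<and> (\<forall>y. 0 \<le> y \<and> y < r \<longrightarrow> fhat y = poly (Q d) y)"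
    using D(7) cd1[of 0] by (intro bexI[OF _ D(6)] exI[of _ r]) (auto simp: D(8,9))
  ultimately show ?case using der D(4)[of y] D(5)[of y] cd1[of y] cd2[of y] cd3[of y] by simp
qed

text \<open>The auxiliary functions compare \<open>x * fhat'' x\<close> with multiples of \<open>fhat' x\<close>; their derivatives
  have a sign because \<open>max_elast\<close>, the elasticity of \<open>fhat''\<close>, is nondecreasing and bounded.\<close>
lemma safe_envelope_elastic:
  assumes env: "safe_envelope J g fhat"
  shows "elastic_up_to_slope (real \<tau>) (real \<sigma>) fhat" "second_elasticity_bounds (real \<tau>) (real \<sigma>) fhat"
    and "1 < \<tau> \<Longrightarrow> cost_deriv fhat 0 = 0"
proof -
  define D1 D2 D3 where D1_def: "D1 = cost_deriv fhat" and D2_def: "D2 = cost_deriv D1" and D3_def: "D3 = cost_deriv D2"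
  note D_defs = D1_def D2_def D3_def
  note envD = safe_envelope_cost_derivs[OF env, folded D_defs]
  note der = envD(1-3) and D2 = envD(5) and D3 = envD(6)
  obtain d r where d: "d \<in> J" "D1 0 = poly (pderiv (Q d)) 0"
    and r: "0 < r" "\<And>y. 0 \<le> y \<Longrightarrow> y < r \<Longrightarrow> fhat y = poly (Q d) y"
    using envD(7) by blast
  have D10: "D1 0 = (if \<tau> = 1 then thr d 1 else 0)"
    unfolding d(2) poly_0_coeff_0 coeff_pderiv coeff_cost_poly using tau sigma by auto
  have D10_nonneg: "0 \<le> D1 0"
    using thr_coeffs[OF d(1)] tau unfolding D10 poly_coeffs_def by auto
  have f0: "fhat 0 = 0"
    using r(2)[of 0] r(1) tau by (simp add: poly_0_coeff_0 coeff_cost_poly)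
  show "cost_deriv fhat 0 = 0" if "1 < \<tau>" using that D10 by (simp add: D1_def)
  have D1_strict: "D1 x < D1 y" if "0 \<le> x" "x < y" for x y
    by (rule increasing_within_half_line[where f' = D2]) (use that der D2 in auto)
  have D1_pos: "0 < D1 y" if "0 < y" for y using D1_strict[of 0 y] that D10_nonneg by simp
  have f_strict: "fhat x < fhat y" if "0 \<le> x" "x < y" for x y
    by (rule increasing_within_half_line[where f' = D1]) (use that der D1_pos in auto)
  have scale: "x * (c * D2 x - (D2 x + x * D3 x)) = x * ((c - 1 - max_elast x) * D2 x)" if "0 < x" for c x
    using D3[OF that] by (simp add: algebra_simps)
  have aux: "c * D2 x - (D2 x + x * D3 x) = (c - 1 - max_elast x) * D2 x" if "0 < x" for c x
    using scale[OF that] that by simp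
  have der_aux: "((\<lambda>x. c * D1 x - x * D2 x) has_real_derivative c * D2 x - (D2 x + x * D3 x)) (at x within {0..})"
    if "0 \<le> x" for c x
    using that by (auto intro!: derivative_eq_intros der)
  have upper: "y * D2 y \<le> c * D1 y" if "0 < y" "0 \<le> c" "\<And>x. 0 < x \<Longrightarrow> x < y \<Longrightarrow> max_elast x \<le> c - 1" for c y
  proof -
    have "(\<lambda>x. c * D1 x - x * D2 x) 0 \<le> (\<lambda>x. c * D1 x - x * D2 x) y"
    proof (rule nondecreasing_within_half_line[OF _ _ der_aux])
      fix x assume "0 < x" "x < y"
      then show "0 \<le> c * D2 x - (D2 x + x * D3 x)"
        unfolding aux[OF \<open>0 < x\<close>] using that(3)[of x] D2[of x] by simp
    qed (use that in auto)
    moreover have "0 \<le> c * D1 0" using that(2) D10_nonneg by simp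
    ultimately show ?thesis by simp
  qed
  have lower: "(real \<tau> - 1) * D1 y \<le> y * D2 y" if "0 < y" for y
  proof -
    let ?c = "real \<tau> - 1"
    have "(\<lambda>x. - (?c * D1 x - x * D2 x)) 0 \<le> (\<lambda>x. - (?c * D1 x - x * D2 x)) y"
    proof (rule nondecreasing_within_half_line[OF _ _ DERIV_minus[OF der_aux]])
      fix x assume x: "0 < x" "x < y"
      show "0 \<le> - (?c * D2 x - (D2 x + x * D3 x))"
        unfolding aux[OF x(1)] using max_elast_bounds(2)[OF x(1)] D2[OF x(1)]
        by (simp add: mult_nonpos_nonneg)
    qed (use that in auto)
    \<comment> \<open>Either \<tau> = 1 and the factor vanishes, or the slope at 0 does.\<close>
    moreover have "?c * D1 0 = 0" using D10 by auto
    ultimately show ?thesis by simp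
  qed
  have E1: "elasticity (cost_deriv fhat) y = y * D2 y / D1 y" if "0 < y" for y
    using that by (simp add: elasticity_def D_defs)
  have mono: "y * D2 y / D1 y \<le> z * D2 z / D1 z" if yz: "0 < y" "y \<le> z" for y z
  proof (rule nondecreasing_within_half_line[where f = "\<lambda>y. y * D2 y / D1 y"
        and f' = "\<lambda>y. ((D2 y + y * D3 y) * D1 y - y * D2 y * D2 y) / (D1 y * D1 y)"])
    fix x assume "y \<le> x" "x \<le> z"
    then show "((\<lambda>y. y * D2 y / D1 y) has_real_derivative
        ((D2 x + x * D3 x) * D1 x - x * D2 x * D2 x) / (D1 x * D1 x)) (at x within {0..})"
      using yz D1_pos[of x] by (auto intro!: derivative_eq_intros der simp: algebra_simps)
  next
    fix x assume "y < x" "x < z"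
    then have x: "0 < x" using yz by simp
    \<comment> \<open>\<open>max_elast\<close> is nondecreasing, hence at most its value at x on all
      of (0, x), and \<open>upper\<close> applies with c = 1 + max_elast x. The elasticity of fhat'
      is thus at most 1 plus that of fhat'', which is exactly nonnegativity of its own
      derivative.\<close>
    have "x * D2 x \<le> (1 + max_elast x) * D1 x"
      by (rule upper) (use x max_elast_bounds(1)[OF x] max_elast_mono in auto)
    then have "(x * D2 x) * D2 x \<le> ((1 + max_elast x) * D1 x) * D2 x"
      using D2[OF x] by (intro mult_right_mono) auto
    then have "0 \<le> (D2 x + x * D3 x) * D1 x - x * D2 x * D2 x"
      unfolding D3[OF x] by (simp add: algebra_simps)
    then show "0 \<le> ((D2 x + x * D3 x) * D1 x - x * D2 x * D2 x) / (D1 x * D1 x)"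
      using D1_pos[OF x] by simp
  qed (use yz in auto)
  have E1_bounds: "real \<tau> - 1 \<le> y * D2 y / D1 y" "y * D2 y / D1 y \<le> real \<sigma> - 1" if "0 < y" for y
    using lower[OF that] upper[OF that, of "real \<sigma> - 1"] max_elast_bounds(3) sigma D1_pos[OF that]
    by (auto simp: pos_le_divide_eq pos_divide_le_eq)
  show "second_elasticity_bounds (real \<tau>) (real \<sigma>) fhat"
    unfolding second_elasticity_bounds_def
  proof (intro allI impI)
    fix y :: real assume y: "0 < y"
    have "elasticity (cost_deriv (cost_deriv fhat)) y = max_elast y"
      using y D3[OF y] D2[OF y] by (simp add: elasticity_def D_defs)
    then show "real \<tau> - 2 \<le> elasticity (cost_deriv (cost_deriv fhat)) y \<and>
        elasticity (cost_deriv (cost_deriv fhat)) y \<le> real \<sigma> - 2"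
      using max_elast_bounds[OF y] by simp
  qed
  have "smooth_cost fhat"
    unfolding smooth_cost_def
  proof (intro conjI allI impI)
    fix j :: nat and y :: real assume j: "j < 3" and y: "0 \<le> y"
    consider "j = 0" | "j = 1" | "j = 2" using j by linarith
    then show "((cost_deriv ^^ j) fhat has_real_derivative (cost_deriv ^^ Suc j) fhat y) (at y within {0..})"
      using der[OF y] by cases (simp_all add: D_defs numeral_2_eq_2)
  next
    show "continuous_on {0..} ((cost_deriv ^^ 3) fhat)"
      using envD(4) by (simp add: D_defs numeral_3_eq_3)
  qed
  moreover have "strict_mono_on {0..} fhat" using f_strict by (auto intro!: strict_mono_onI)
  moreover have "0 \<le> fhat y" if "0 \<le> y" for y
    using f_strict[of 0 y] f0 that by (cases "y = 0") auto
  moreover have "strictly_convex_on {0..} fhat"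
    by (rule strictly_convex_onI[OF der(1) D1_strict])
  moreover have "analytic_at_origin fhat" by (rule poly_analytic_at_origin[OF r])
  moreover have "mono_on {0<..} (elasticity (cost_deriv fhat))"
    using mono by (auto intro!: mono_onI simp: E1)
  ultimately show "elastic_up_to_slope (real \<tau>) (real \<sigma>) fhat"
    unfolding elastic_up_to_slope_def using f0 E1 E1_bounds by simp
qed

text \<open>The ratio \<open>fhat'' / f''\<close> is nondecreasing, since its logarithmic derivative is the difference
  of the second elasticities divided by the argument.\<close>
lemma safe_envelope_slope_le:
  assumes env: "safe_envelope J g fhat"
    and c: "poly_coeffs \<tau> \<sigma> c" "\<forall>k\<in>{\<tau>..\<sigma>}. lo k \<le> c k \<and> c k \<le> hi k"
    and yz: "0 < y" "y \<le> z"
  defines "p \<equiv> cost_poly \<tau> \<sigma> c"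
  shows "(cost_deriv fhat z - cost_deriv fhat y) / (z * cost_deriv (cost_deriv fhat) z)
    \<le> (poly (pderiv p) z - poly (pderiv p) y) / (z * poly (pderiv (pderiv p)) z)"
proof -
  define D1 D2 D3 where D1_def: "D1 = cost_deriv fhat" and D2_def: "D2 = cost_deriv D1" and D3_def: "D3 = cost_deriv D2"
  note D_defs = D1_def D2_def D3_def
  note envD = safe_envelope_cost_derivs[OF env, folded D_defs]
  note der = envD(1-3) and D2 = envD(5) and D3 = envD(6)
  let ?p1 = "poly (pderiv p)" and ?p2 = "poly (pderiv (pderiv p))" and ?p3 = "poly (pderiv (pderiv (pderiv p)))"
  have z: "0 < z" using yz by simp
  have p2: "0 < ?p2 x" if "0 < x" for x
    using pderiv2_pos[OF c(1) that] by (simp add: p_def pderiv2_eq)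
  have p3: "x * ?p3 x = elast2 \<tau> \<sigma> c x * ?p2 x" if "0 < x" for x
    using pderiv3_elast2[OF c(1) that] by (simp add: p_def pderiv2_eq pderiv3_eq)
  have derp: "(?p1 has_real_derivative ?p2 x) (at x within {0..})"
    "(?p2 has_real_derivative ?p3 x) (at x within {0..})" for x
    by (auto intro: DERIV_subset[OF poly_DERIV])
  have ratio: "D2 x / ?p2 x \<le> D2 z / ?p2 z" if x: "0 < x" "x \<le> z" for x
  proof (rule nondecreasing_within_half_line[where f = "\<lambda>x. D2 x / ?p2 x"
        and f' = "\<lambda>x. (D3 x * ?p2 x - D2 x * ?p3 x) / (?p2 x * ?p2 x)"])
    fix t assume "x \<le> t" "t \<le> z"
    then show "((\<lambda>x. D2 x / ?p2 x) has_real_derivative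
        (D3 t * ?p2 t - D2 t * ?p3 t) / (?p2 t * ?p2 t)) (at t within {0..})"
      using x p2[of t] by (intro DERIV_divide der derp) auto
  next
    fix t assume "x < t" "t < z"
    then have t: "0 < t" using x by simp
    have "t * (D3 t * ?p2 t - D2 t * ?p3 t) = (t * D3 t) * ?p2 t - D2 t * (t * ?p3 t)"
      by (simp add: algebra_simps)
    also have "\<dots> = (max_elast t - elast2 \<tau> \<sigma> c t) * (D2 t * ?p2 t)"
      unfolding D3[OF t] p3[OF t] by (simp add: algebra_simps)
    finally have "0 \<le> t * (D3 t * ?p2 t - D2 t * ?p3 t)"
      using elast2_le_max_elast[OF c t] D2[OF t] p2[OF t] by simp
    then have "0 \<le> D3 t * ?p2 t - D2 t * ?p3 t" using t by (simp add: zero_le_mult_iff)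
    then show "0 \<le> (D3 t * ?p2 t - D2 t * ?p3 t) / (?p2 t * ?p2 t)" by simp
  qed (use x in auto)
  \<comment> \<open>The monotone ratio, integrated from y to z: comparing it at x and at z gives the
    derivative of this function its sign.\<close>
  have "(\<lambda>x. D2 z * ?p1 x - ?p2 z * D1 x) y \<le> (\<lambda>x. D2 z * ?p1 x - ?p2 z * D1 x) z"
  proof (rule nondecreasing_within_half_line[where f = "\<lambda>x. D2 z * ?p1 x - ?p2 z * D1 x"
        and f' = "\<lambda>x. D2 z * ?p2 x - ?p2 z * D2 x"])
    fix x assume "y \<le> x" "x \<le> z"
    then show "((\<lambda>x. D2 z * ?p1 x - ?p2 z * D1 x) has_real_derivative D2 z * ?p2 x - ?p2 z * D2 x) (at x within {0..})"
      using yz by (auto intro!: derivative_eq_intros der derp)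
  next
    fix x assume "y < x" "x < z"
    then show "0 \<le> D2 z * ?p2 x - ?p2 z * D2 x"
      using ratio[of x] p2[of x] p2[OF z] yz by (simp add: field_simps)
  qed (use yz in auto)
  then have "?p2 z * (D1 z - D1 y) \<le> D2 z * (?p1 z - ?p1 y)" by (simp add: algebra_simps)
  then have "(D1 z - D1 y) / D2 z \<le> (?p1 z - ?p1 y) / ?p2 z"
    using p2[OF z] D2[OF z] by (simp add: field_simps)
  then have "(D1 z - D1 y) / D2 z / z \<le> (?p1 z - ?p1 y) / ?p2 z / z"
    using z by (intro divide_right_mono) auto
  then show ?thesis using yz by (simp add: D_defs mult.commute)
qed

end

section \<open>Competitiveness of a design\<close>

text \<open>Collects what the competitiveness and comparison arguments use about a single cost f. S
  bounds the elasticity of f'' and enters the Lipschitz constant of the design equation. The slope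
  at 0 may be positive, which covers \<tau> = 1.\<close>

locale regular_poly =
  fixes p :: "real poly" and S :: real
  assumes p_0: "poly p 0 = 0"
    and p2_pos: "0 < y \<Longrightarrow> 0 < poly (pderiv (pderiv p)) y"
    and p3_nonneg: "0 < y \<Longrightarrow> 0 \<le> poly (pderiv (pderiv (pderiv p))) y"
    and p3_le: "0 < y \<Longrightarrow> y * poly (pderiv (pderiv (pderiv p))) y \<le> S * poly (pderiv (pderiv p)) y"
begin

abbreviation "p1 \<equiv> poly (pderiv p)"
abbreviation "p2 \<equiv> poly (pderiv (pderiv p))"
abbreviation "p3 \<equiv> poly (pderiv (pderiv (pderiv p)))"

lemma p1_mono: "0 \<le> x \<Longrightarrow> x \<le> y \<Longrightarrow> p1 x \<le> p1 y"
  by (rule nondecreasing_within_half_line[where f = p1 and f' = p2])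
    (auto intro: DERIV_subset[OF poly_DERIV] less_imp_le[OF p2_pos])

lemma p2_mono: "0 \<le> x \<Longrightarrow> x \<le> y \<Longrightarrow> p2 x \<le> p2 y"
  by (rule nondecreasing_within_half_line[where f = p2 and f' = p3])
    (auto intro: DERIV_subset[OF poly_DERIV] p3_nonneg)

lemma p_tangent:
  assumes "0 \<le> x" "0 \<le> y"
  shows "poly p x + p1 x * (y - x) \<le> poly p y"
proof (cases "x \<le> y")
  case True
  have "(\<lambda>t. poly p t - p1 x * t) x \<le> (\<lambda>t. poly p t - p1 x * t) y"
    by (rule nondecreasing_within_half_line[where f' = "\<lambda>t. p1 t - p1 x"])
      (use assms True in \<open>auto intro!: derivative_eq_intros DERIV_subset[OF poly_DERIV] p1_mono\<close>)
  then show ?thesis by (simp add: algebra_simps)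
next
  case False
  have "(\<lambda>t. p1 x * t - poly p t) y \<le> (\<lambda>t. p1 x * t - poly p t) x"
    by (rule nondecreasing_within_half_line[where f' = "\<lambda>t. p1 x - p1 t"])
      (use assms False in \<open>auto intro!: derivative_eq_intros DERIV_subset[OF poly_DERIV] p1_mono\<close>)
  then show ?thesis by (simp add: algebra_simps)
qed

lemma cost_deriv_p: "0 \<le> y \<Longrightarrow> cost_deriv (poly p) y = p1 y"
  by (rule cost_deriv_eqI) (auto intro: DERIV_subset[OF poly_DERIV])

lemma cost_deriv2_p: "0 \<le> y \<Longrightarrow> cost_deriv (cost_deriv (poly p)) y = p2 y"
  by (rule cost_deriv_eqI, rule has_real_derivative_cong_half_line[of p1])
    (auto intro: DERIV_subset[OF poly_DERIV] simp: cost_deriv_p)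

end

text \<open>P stays below P c to the left of c and above it to the right, so the signed integral
  from b to c obeys the bound in either order of b and c. It linearizes the pseudo-cost without
  differentiating it.\<close>

lemma integral_le_mult_upper:
  fixes P :: "real \<Rightarrow> real"
  assumes cont: "continuous_on {0..} P" and mono: "\<And>x y. 0 \<le> x \<Longrightarrow> x \<le> y \<Longrightarrow> P x \<le> P y"
    and "0 \<le> a" "a \<le> b" "a \<le> c"
  shows "integral {a..c} P - integral {a..b} P \<le> (c - b) * P c"
proof -
  have int: "P integrable_on {x..y}" if "0 \<le> x" for x y
    by (rule integrable_continuous_real[OF continuous_on_subset[OF cont]]) (use that in auto)
  show ?thesis
  proof (cases "b \<le> c")
    case True
    have "integral {a..b} P + integral {b..c} P = integral {a..c} P"
      by (rule Henstock_Kurzweil_Integration.integral_combine) (use assms True int in auto)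
    moreover have "integral {b..c} P \<le> integral {b..c} (\<lambda>_. P c)"
      by (rule integral_le) (use assms True int in auto)
    ultimately show ?thesis using True by simp
  next
    case False
    have "integral {a..c} P + integral {c..b} P = integral {a..b} P"
      by (rule Henstock_Kurzweil_Integration.integral_combine) (use assms False int in auto)
    moreover have "integral {c..b} (\<lambda>_. P c) \<le> integral {c..b} P"
      by (rule integral_le) (use assms False int in auto)
    ultimately show ?thesis using False by (simp add: algebra_simps)
  qed
qed

text \<open>First-order optimality in the pseudo-utility problem, with the prices reached after the
  purchase.\<close>
lemma pseudo_utility_first_order:
  fixes P :: "real \<Rightarrow> real"
  assumes cont: "continuous_on {0..} P" and mono: "\<And>x y. 0 \<le> x \<Longrightarrow> x \<le> y \<Longrightarrow> P x \<le> P y"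
    and a: "\<And>j. j < m \<Longrightarrow> 0 \<le> a j" and w: "\<And>j. j < m \<Longrightarrow> 0 < w j"
    and x: "x \<in> decisions m" and z: "z \<in> decisions m"
    and opt: "\<And>z. z \<in> decisions m \<Longrightarrow>
      (\<Sum>j<m. v j * z j) - (\<Sum>j<m. integral {a j..a j + w j * z j} P)
      \<le> (\<Sum>j<m. v j * x j) - (\<Sum>j<m. integral {a j..a j + w j * x j} P)"
  shows "(\<Sum>j<m. (v j - w j * P (a j + w j * x j)) * z j) \<le> (\<Sum>j<m. (v j - w j * P (a j + w j * x j)) * x j)"
proof -
  \<comment> \<open>x is moved towards z. Optimality and the linear bound at the perturbed prices
    give e * G e <= 0, and continuity of P lets e tend to 0.\<close>
  define xe where "xe e j = x j + e * (z j - x j)" for e :: real and j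
  define G where "G e = (\<Sum>j<m. (v j - w j * P (a j + w j * xe e j)) * (z j - x j))" for e
  have xe_nonneg: "0 \<le> xe e j" if "j < m" "0 \<le> e" "e \<le> 1" for e j
  proof -
    have "xe e j = (1 - e) * x j + e * z j" by (simp add: xe_def algebra_simps)
    moreover have "0 \<le> x j" "0 \<le> z j" using x z that by (auto simp: decisions_def)
    ultimately show ?thesis using that by simp
  qed
  have G_nonpos: "G e \<le> 0" if e: "0 < e" "e \<le> 1" for e
  proof -
    have "xe e \<in> decisions m"
    proof -
      have "(\<Sum>j<m. xe e j) = (1 - e) * (\<Sum>j<m. x j) + e * (\<Sum>j<m. z j)"
        by (simp add: xe_def algebra_simps sum.distrib sum_subtractf sum_distrib_left)
      also have "\<dots> \<le> (1 - e) * 1 + e * 1"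
        using x z e by (intro add_mono mult_left_mono) (auto simp: decisions_def)
      finally show ?thesis using xe_nonneg e by (simp add: decisions_def)
    qed
    from opt[OF this] have "0 \<le> (\<Sum>j<m. v j * x j) - (\<Sum>j<m. v j * xe e j)
        + (\<Sum>j<m. integral {a j..a j + w j * xe e j} P - integral {a j..a j + w j * x j} P)"
      by (simp add: sum_subtractf)
    also have "\<dots> \<le> (\<Sum>j<m. v j * x j) - (\<Sum>j<m. v j * xe e j)
        + (\<Sum>j<m. ((a j + w j * xe e j) - (a j + w j * x j)) * P (a j + w j * xe e j))"
    proof (intro add_left_mono sum_mono integral_le_mult_upper[OF cont mono])
      fix j assume "j \<in> {..<m}"
      then show "0 \<le> a j" "a j \<le> a j + w j * x j" "a j \<le> a j + w j * xe e j"
        using a w[of j] x xe_nonneg[of j e] e by (auto simp: decisions_def)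
    qed auto
    also have "\<dots> = - (e * G e)"
      unfolding G_def sum_distrib_left sum_subtractf[symmetric] sum.distrib[symmetric] sum_negf[symmetric]
      by (intro sum.cong refl) (simp add: xe_def algebra_simps)
    finally show ?thesis using e by (simp add: mult_le_0_iff)
  qed
  have "continuous_on {0..1} G"
    unfolding G_def
  proof (intro continuous_on_sum continuous_on_mult continuous_on_diff continuous_on_const)
    fix j assume j: "j \<in> {..<m}"
    show "continuous_on {0..1} (\<lambda>e. P (a j + w j * xe e j))"
    proof (rule continuous_on_compose2[OF cont])
      show "continuous_on {0..1} (\<lambda>e. a j + w j * xe e j)"
        unfolding xe_def by (intro continuous_intros)
      have "0 \<le> a j + w j * xe e j" if "e \<in> {0..1}" for e
        using a[of j] w[of j] xe_nonneg[of j e] j that by simp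
      then show "(\<lambda>e. a j + w j * xe e j) ` {0..1} \<subseteq> {0..}" by auto
    qed
  qed
  then have "(G \<longlongrightarrow> G 0) (at 0 within {0..1})" by (simp add: continuous_on_def)
  then have "(G \<longlongrightarrow> G 0) (at_right 0)"
    by (simp add: at_within_Icc_at_right)
  moreover have "\<forall>\<^sub>F e in at_right 0. G e \<le> 0"
    by (rule eventually_mono[OF eventually_at_right_real[of 0 1]]) (auto intro: G_nonpos)
  ultimately have "G 0 \<le> 0" by (intro tendsto_upperbound) auto
  then show ?thesis by (simp add: G_def xe_def right_diff_distrib sum_subtractf)
qed

context regular_poly
begin

text \<open>Online primal-dual argument. With the prices \<open>P = f' \<circ> \<phi>\<close>, weak duality bounds the optimum by
  the utilities of the arrivals plus the conjugate costs \<open>\<phi> * P - f \<circ> \<phi>\<close>; the differential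
  inequality bounds the latter by \<open>\<alpha>\<close> times the accumulated pseudo-cost minus the cost.\<close>
lemma competitive_design_of_diff_ineq:
  assumes "1 \<le> \<alpha>" and \<phi>0: "\<phi> 0 = 0"
    and \<phi>: "\<And>y. 0 \<le> y \<Longrightarrow> y \<le> \<phi> y"
    and \<phi>_der: "\<And>y. 0 \<le> y \<Longrightarrow> (\<phi> has_real_derivative \<phi>' y) (at y within {0..})"
    and \<phi>'_nonneg: "\<And>y. 0 \<le> y \<Longrightarrow> 0 \<le> \<phi>' y"
    and ineq: "\<And>y. 0 < y \<Longrightarrow> \<phi>' y * (\<phi> y * p2 (\<phi> y)) \<le> \<alpha> * (p1 (\<phi> y) - p1 y)"
  shows "competitive_design m \<alpha> (poly p) \<phi>"
  unfolding competitive_design_def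
proof (intro allI impI, elim conjE)
  fix T v w x
  assume inst: "oacc_instance m T v w" and run: "pumax_run m (poly p) \<phi> T v w x"
  define P where "P y = p1 (\<phi> y)" for y
  have \<phi>_nonneg: "0 \<le> \<phi> y" if "0 \<le> y" for y using \<phi>[OF that] that by simp
  have \<phi>_mono: "\<phi> y \<le> \<phi> z" if "0 \<le> y" "y \<le> z" for y z
    by (rule nondecreasing_within_half_line[where f = \<phi> and f' = \<phi>']) (use that \<phi>_der \<phi>'_nonneg in auto)
  have P_mono: "P y \<le> P z" if "0 \<le> y" "y \<le> z" for y z
    unfolding P_def using that \<phi>_mono \<phi>_nonneg by (intro p1_mono) auto
  have P_der: "(P has_real_derivative p2 (\<phi> y) * \<phi>' y) (at y within {0..})" if "0 \<le> y" for y
    unfolding P_def using DERIV_chain2[OF poly_DERIV \<phi>_der[OF that]] by simp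
  have P_cont: "continuous_on {0..} P" by (rule DERIV_continuous_on[OF P_der]) simp
  define I where "I y = integral {0..y} P" for y
  have conj_le: "\<phi> y * P y - poly p (\<phi> y) \<le> \<alpha> * (I y - poly p y)" if "0 \<le> y" for y
  proof -
    \<comment> \<open>In the derivative of \<phi> * P - f \<circ> \<phi> the two terms P * \<phi>'
      cancel; what remains is the left side of \<open>ineq\<close>.\<close>
    let ?V = "\<lambda>y. \<alpha> * (I y - poly p y) - (\<phi> y * P y - poly p (\<phi> y))"
    have "?V 0 \<le> ?V y"
    proof (rule nondecreasing_within_half_line[where f = ?V and
          f' = "\<lambda>y. \<alpha> * (P y - p1 y) - \<phi> y * (p2 (\<phi> y) * \<phi>' y)"])
      fix t assume t: "0 \<le> t" "t \<le> y"
      have "(I has_real_derivative P t) (at t within {0..})"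
        unfolding I_def by (rule integral_has_real_derivative_half_line[OF P_cont t(1)])
      moreover have "((\<lambda>y. poly p (\<phi> y)) has_real_derivative P t * \<phi>' t) (at t within {0..})"
        unfolding P_def by (rule DERIV_chain2[OF poly_DERIV \<phi>_der[OF t(1)]])
      moreover have "(poly p has_real_derivative p1 t) (at t within {0..})"
        by (auto intro: DERIV_subset[OF poly_DERIV])
      ultimately have "(?V has_real_derivative \<alpha> * (P t - p1 t)
          - (\<phi>' t * P t + p2 (\<phi> t) * \<phi>' t * \<phi> t - P t * \<phi>' t)) (at t within {0..})"
        by (intro DERIV_diff DERIV_cmult DERIV_mult \<phi>_der P_der t)
      then show "(?V has_real_derivative \<alpha> * (P t - p1 t) - \<phi> t * (p2 (\<phi> t) * \<phi>' t)) (at t within {0..})"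
        by (simp add: algebra_simps)
    next
      fix t assume "0 < t" "t < y"
      then show "0 \<le> \<alpha> * (P t - p1 t) - \<phi> t * (p2 (\<phi> t) * \<phi>' t)"
        using ineq[of t] by (simp add: P_def algebra_simps)
    qed (use that in auto)
    moreover have "?V 0 = 0" by (simp add: I_def \<phi>0 p_0)
    ultimately show ?thesis by simp
  qed
  define a where "a = utilization w x"
  have w: "0 < w t j" and x: "0 \<le> x t j" if "t < T" "j < m" for t j
    using inst run that by (auto simp: oacc_instance_def pumax_run_def decisions_def)
  have wx: "0 \<le> w t j * x t j" if "t < T" "j < m" for t j
    using w[OF that] x[OF that] by simp
  have a_Suc: "a (Suc t) j = a t j + w t j * x t j" for t j by (simp add: a_def utilization_def)
  have a_nonneg: "0 \<le> a t j" if "t \<le> T" "j < m" for t j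
    unfolding a_def utilization_def using that wx
    by (intro sum_nonneg) auto
  have a_le: "a t j \<le> a T j" if "t \<le> T" "j < m" for t j
    unfolding a_def utilization_def using that wx
    by (intro sum_mono2) auto
  \<comment> \<open>q is the marginal profit at the price reached after arrival t, and u t acts as
    the dual variable of the constraint that the decision sums to at most 1.\<close>
  define q where "q t j = v t j - w t j * P (a (Suc t) j)" for t j
  define u where "u t = (\<Sum>j<m. q t j * x t j)" for t
  have u_max: "(\<Sum>j<m. q t j * z j) \<le> u t" if t: "t < T" and z: "z \<in> decisions m" for t z
    unfolding u_def q_def a_Suc
  proof (rule pseudo_utility_first_order[OF P_cont P_mono])
    show "x t \<in> decisions m" using run t by (simp add: pumax_run_def)
    fix z assume z: "z \<in> decisions m"
    have util: "pseudo_utility m (poly p) \<phi> (v t) (w t) (utilization w x t) z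
        = (\<Sum>j<m. v t j * z j) - (\<Sum>j<m. integral {a t j..a t j + w t j * z j} P)" for z
    proof -
      have "integral {a t j..a t j + w t j * z j} (\<lambda>\<eta>. cost_deriv (poly p) (\<phi> \<eta>))
          = integral {a t j..a t j + w t j * z j} P" if "j < m" for j
        by (rule Henstock_Kurzweil_Integration.integral_cong)
          (use a_nonneg[of t j] that t \<phi>_nonneg in \<open>auto simp: P_def cost_deriv_p\<close>)
      then show ?thesis by (simp add: pseudo_utility_def a_def)
    qed
    show "(\<Sum>j<m. v t j * z j) - (\<Sum>j<m. integral {a t j..a t j + w t j * z j} P)
        \<le> (\<Sum>j<m. v t j * x t j) - (\<Sum>j<m. integral {a t j..a t j + w t j * x t j} P)"
      using run t z unfolding util[symmetric] by (simp add: pumax_run_def)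
  qed (use a_nonneg w t z in auto)
  have u_nonneg: "0 \<le> u t" if "t < T" for t
    using u_max[OF that, of "\<lambda>_. 0"] by (simp add: decisions_def)
  define U where "U = (\<Sum>t<T. u t)"
  have "0 \<le> U" unfolding U_def by (intro sum_nonneg u_nonneg) auto
  \<comment> \<open>Charging each purchase entirely at the price reached after it overestimates the
    integral, as P is nondecreasing.\<close>
  have I_le: "I (a T j) \<le> (\<Sum>t<T. w t j * P (a (Suc t) j) * x t j)" if j: "j < m" for j
  proof -
    have "I (a n j) \<le> (\<Sum>t<n. w t j * P (a (Suc t) j) * x t j)" if "n \<le> T" for n
      using that
    proof (induction n)
      case 0
      then show ?case by (simp add: I_def a_def utilization_def)
    next
      case (Suc n)
      have "integral {0..a (Suc n) j} P - integral {0..a n j} P \<le> (a (Suc n) j - a n j) * P (a (Suc n) j)"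
        by (rule integral_le_mult_upper[OF P_cont P_mono]) (use Suc a_nonneg j in auto)
      then show ?case using Suc by (simp add: I_def a_Suc mult.commute mult.left_commute)
    qed
    then show ?thesis by simp
  qed
  have alg: "U + (\<Sum>j<m. I (a T j) - poly p (a T j)) \<le> oacc_objective m (poly p) T v w x"
  proof -
    have "(\<Sum>t<T. \<Sum>j<m. v t j * x t j) = U + (\<Sum>t<T. \<Sum>j<m. w t j * P (a (Suc t) j) * x t j)"
      unfolding U_def u_def q_def sum.distrib[symmetric] by (simp add: algebra_simps)
    also have "\<dots> = U + (\<Sum>j<m. \<Sum>t<T. w t j * P (a (Suc t) j) * x t j)"
      by (rule arg_cong2[where f = "(+)", OF refl sum.swap])
    finally have "(\<Sum>t<T. \<Sum>j<m. v t j * x t j) = U + (\<Sum>j<m. \<Sum>t<T. w t j * P (a (Suc t) j) * x t j)" .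
    moreover have "(\<Sum>j<m. I (a T j)) \<le> (\<Sum>j<m. \<Sum>t<T. w t j * P (a (Suc t) j) * x t j)"
      by (intro sum_mono I_le) simp
    ultimately show ?thesis by (simp add: oacc_objective_def sum_subtractf a_def utilization_def)
  qed
  \<comment> \<open>Weak duality: prices only rise, so all demand may be charged at P (a T j); by
    convexity P (a T j) * Y - f Y is then largest at Y = \<phi> (a T j), where f' equals that
    price.\<close>
  have dual: "oacc_objective m (poly p) T v w z \<le> U + (\<Sum>j<m. \<phi> (a T j) * P (a T j) - poly p (\<phi> (a T j)))"
    if z: "\<forall>t<T. z t \<in> decisions m" for z
  proof -
    have z0: "0 \<le> z t j" if "t < T" "j < m" for t j using z that by (auto simp: decisions_def)
    define Y where "Y j = (\<Sum>t<T. w t j * z t j)" for j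
    have Y: "0 \<le> Y j" if "j < m" for j
      unfolding Y_def using that less_imp_le[OF w] z0 by (intro sum_nonneg mult_nonneg_nonneg) auto
    have "(\<Sum>t<T. \<Sum>j<m. v t j * z t j) \<le> (\<Sum>t<T. u t + (\<Sum>j<m. P (a T j) * (w t j * z t j)))"
    proof (rule sum_mono)
      fix t assume t: "t \<in> {..<T}"
      have "(\<Sum>j<m. v t j * z t j) = (\<Sum>j<m. q t j * z t j) + (\<Sum>j<m. P (a (Suc t) j) * (w t j * z t j))"
        unfolding q_def sum.distrib[symmetric] by (simp add: algebra_simps)
      also have "\<dots> \<le> u t + (\<Sum>j<m. P (a T j) * (w t j * z t j))"
      proof (intro add_mono u_max sum_mono mult_right_mono P_mono)
        fix j assume "j \<in> {..<m}"
        then show "0 \<le> a (Suc t) j" "a (Suc t) j \<le> a T j" "0 \<le> w t j * z t j"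
          using a_nonneg[of "Suc t" j] a_le[of "Suc t" j] w[of t j] z0[of t j] t by auto
      qed (use t z in auto)
      finally show "(\<Sum>j<m. v t j * z t j) \<le> u t + (\<Sum>j<m. P (a T j) * (w t j * z t j))" .
    qed
    also have "\<dots> = U + (\<Sum>t<T. \<Sum>j<m. P (a T j) * (w t j * z t j))" by (simp add: U_def sum.distrib)
    also have "\<dots> = U + (\<Sum>j<m. \<Sum>t<T. P (a T j) * (w t j * z t j))"
      by (rule arg_cong2[where f = "(+)", OF refl sum.swap])
    also have "\<dots> = U + (\<Sum>j<m. P (a T j) * Y j)" by (simp add: Y_def sum_distrib_left)
    finally have "oacc_objective m (poly p) T v w z \<le> U + (\<Sum>j<m. P (a T j) * Y j - poly p (Y j))"
      by (simp add: oacc_objective_def sum_subtractf Y_def)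
    also have "\<dots> \<le> U + (\<Sum>j<m. \<phi> (a T j) * P (a T j) - poly p (\<phi> (a T j)))"
    proof (intro add_left_mono sum_mono)
      fix j assume "j \<in> {..<m}"
      then show "P (a T j) * Y j - poly p (Y j) \<le> \<phi> (a T j) * P (a T j) - poly p (\<phi> (a T j))"
        using p_tangent[of "\<phi> (a T j)" "Y j"] Y[of j] \<phi>_nonneg a_nonneg[of T j]
        by (simp add: P_def algebra_simps)
    qed
    finally show ?thesis .
  qed
  have "oacc_opt m (poly p) T v w \<le> U + (\<Sum>j<m. \<phi> (a T j) * P (a T j) - poly p (\<phi> (a T j)))"
    unfolding oacc_opt_def
  proof (rule cSUP_least)
    have "(\<lambda>_ _. 0) \<in> {x. \<forall>t<T. x t \<in> decisions m}" by (simp add: decisions_def)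
    then show "{x. \<forall>t<T. x t \<in> decisions m} \<noteq> {}" by (metis empty_iff)
    fix z assume "z \<in> {x. \<forall>t<T. x t \<in> decisions m}"
    then have "\<forall>t<T. z t \<in> decisions m" by (rule CollectD)
    then show "oacc_objective m (poly p) T v w z
        \<le> U + (\<Sum>j<m. \<phi> (a T j) * P (a T j) - poly p (\<phi> (a T j)))" by (rule dual)
  qed
  also have "\<dots> \<le> \<alpha> * U + (\<Sum>j<m. \<alpha> * (I (a T j) - poly p (a T j)))"
  proof (intro add_mono sum_mono conj_le)
    show "U \<le> \<alpha> * U" using mult_right_mono[OF \<open>1 \<le> \<alpha>\<close> \<open>0 \<le> U\<close>] by simp
  qed (use a_nonneg in auto)
  also have "\<dots> = \<alpha> * (U + (\<Sum>j<m. I (a T j) - poly p (a T j)))"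
    by (simp add: distrib_left sum_distrib_left)
  also have "\<dots> \<le> \<alpha> * oacc_objective m (poly p) T v w x"
    using alg \<open>1 \<le> \<alpha>\<close> by (intro mult_left_mono) auto
  finally show "oacc_opt m (poly p) T v w \<le> \<alpha> * oacc_objective m (poly p) T v w x" .
qed

end

section \<open>Inclusion of design regions\<close>

text \<open>The lowest nonzero coefficient decides; the induction strips off factors y until it
  becomes the constant term.\<close>

lemma poly_eventually_sign:
  fixes p :: "real poly"
  obtains d where "0 < d" "(\<forall>y. 0 < y \<and> y < d \<longrightarrow> 0 \<le> poly p y) \<or> (\<forall>y. 0 < y \<and> y < d \<longrightarrow> poly p y \<le> 0)"
proof -
  have "\<exists>d>0. (\<forall>y. 0 < y \<and> y < d \<longrightarrow> 0 \<le> poly p y) \<or> (\<forall>y. 0 < y \<and> y < d \<longrightarrow> poly p y \<le> 0)"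
  proof (induction p)
    case 0
    show ?case by (rule exI[of _ 1]) simp
  next
    case (pCons a p)
    show ?case
    proof (cases "a = 0")
      case True
      from pCons.IH obtain d where d: "0 < d"
        "(\<forall>y. 0 < y \<and> y < d \<longrightarrow> 0 \<le> poly p y) \<or> (\<forall>y. 0 < y \<and> y < d \<longrightarrow> poly p y \<le> 0)" by blast
      then show ?thesis using True
        by (intro exI[of _ d]) (auto simp: mult_nonneg_nonpos)
    next
      case False
      have lim: "(poly (pCons a p) \<longlongrightarrow> poly (pCons a p) 0) (at_right 0)"
        by (rule tendsto_poly[OF tendsto_ident_at])
      consider "0 < a" | "a < 0" using False by linarith
      then show ?thesis
      proof cases
        case 1
        then have "\<forall>\<^sub>F y in at_right 0. 0 < poly (pCons a p) y"
          using order_tendstoD(1)[OF lim, of 0] by simp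
        then obtain d where "0 < d" "\<forall>y>0. y < d \<longrightarrow> 0 < poly (pCons a p) y"
          unfolding eventually_at_right_field by blast
        then show ?thesis by (intro exI[of _ d]) (auto intro: less_imp_le)
      next
        case 2
        then have "\<forall>\<^sub>F y in at_right 0. poly (pCons a p) y < 0"
          using order_tendstoD(2)[OF lim, of 0] by simp
        then obtain d where "0 < d" "\<forall>y>0. y < d \<longrightarrow> poly (pCons a p) y < 0"
          unfolding eventually_at_right_field by blast
        then show ?thesis by (intro exI[of _ d]) (auto intro: less_imp_le)
      qed
    qed
  qed
  then show ?thesis using that by blast
qed

context regular_poly
begin

text \<open>In the coordinates \<open>y = exp s\<close> and \<open>\<phi> y = y * r\<close> the design equation becomes
  \<open>r' = \<alpha> * slope (exp s) r - r\<close>, whose right-hand side is Lipschitz in \<open>r \<ge> 1\<close> uniformly in \<open>s\<close>.\<close>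
definition slope :: "real \<Rightarrow> real \<Rightarrow> real" where
  "slope y r = (p1 (r * y) - p1 y) / (r * y * p2 (r * y))"

text \<open>As f'' is nondecreasing, f' z - f' y <= (z - y) * f'' z <= z * f'' z for z = r *
  y.\<close>

lemma slope_bounds:
  assumes "0 < y" "1 \<le> r"
  shows "0 \<le> slope y r" "slope y r \<le> 1"
proof -
  define z where "z = r * y"
  have z: "0 < z" "y \<le> z" using assms mult_right_mono[of 1 r y] by (auto simp: z_def)
  have "p1 y \<le> p1 z" using p1_mono[of y z] assms z by simp
  then show "0 \<le> slope y r"
    using p2_pos[OF z(1)] z unfolding slope_def z_def[symmetric] by simp
  have "(\<lambda>x. p2 z * x - p1 x) y \<le> (\<lambda>x. p2 z * x - p1 x) z"
    by (rule nondecreasing_within_half_line[where f = "\<lambda>x. p2 z * x - p1 x" and f' = "\<lambda>x. p2 z - p2 x"])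
      (use assms z p2_mono in \<open>auto intro!: derivative_eq_intros DERIV_subset[OF poly_DERIV]\<close>)
  moreover have "0 \<le> p2 z * y" using p2_pos[OF z(1)] assms by simp
  ultimately have "p1 z - p1 y \<le> z * p2 z" by (simp add: mult.commute)
  then show "slope y r \<le> 1"
    using p2_pos[OF z(1)] z unfolding slope_def z_def[symmetric] by (simp add: pos_divide_le_eq)
qed

lemma S_nonneg: "0 \<le> S"
proof -
  have "0 * p2 1 \<le> S * p2 1" using p3_nonneg[of 1] p3_le[of 1] by simp
  then show ?thesis using p2_pos[of 1] by (simp add: zero_le_mult_iff)
qed

text \<open>The denominator of \<open>slope\<close> has logarithmic derivative (1 + e) / r, where e
  is the elasticity of f'' at r * y; this gives the formula for A'. Since \<open>slope\<close> lies
  in [0, 1], e in [0, S] and r >= 1, the bound 1 + S does not depend on y.\<close>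

lemma slope_lipschitz:
  assumes y: "0 < y" and "1 \<le> a" "1 \<le> b"
  shows "\<bar>slope y a - slope y b\<bar> \<le> (1 + S) * \<bar>a - b\<bar>"
proof -
  define A' where "A' r = (1 - slope y r * (1 + r * y * p3 (r * y) / p2 (r * y))) / r" for r
  have der: "(slope y has_real_derivative A' r) (at r within {1..})" if r: "1 \<le> r" for r
  proof -
    have ry: "0 < r * y" using r y by simp
    note p2 = p2_pos[OF ry]
    have d1: "((\<lambda>r. p1 (r * y)) has_real_derivative p2 (r * y) * y) (at r within {1..})"
      by (rule DERIV_chain2[OF poly_DERIV]) (auto intro!: derivative_eq_intros)
    have d2: "((\<lambda>r. p2 (r * y)) has_real_derivative p3 (r * y) * y) (at r within {1..})"
      by (rule DERIV_chain2[OF poly_DERIV]) (auto intro!: derivative_eq_intros)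
    have "(slope y has_real_derivative
        ((p2 (r * y) * y - 0) * (r * y * p2 (r * y))
          - (p1 (r * y) - p1 y) * (y * p2 (r * y) + p3 (r * y) * y * (r * y)))
        / ((r * y * p2 (r * y)) * (r * y * p2 (r * y)))) (at r within {1..})"
      unfolding slope_def[abs_def] using ry p2
      by (intro DERIV_divide DERIV_diff DERIV_mult d1 d2 DERIV_const) (auto intro!: derivative_eq_intros)
    also have "((p2 (r * y) * y - 0) * (r * y * p2 (r * y))
          - (p1 (r * y) - p1 y) * (y * p2 (r * y) + p3 (r * y) * y * (r * y)))
        / ((r * y * p2 (r * y)) * (r * y * p2 (r * y))) = A' r"
      using r y p2 unfolding A'_def slope_def by (simp add: divide_simps) (simp add: algebra_simps)
    finally show ?thesis .
  qed
  have bound: "\<bar>A' r\<bar> \<le> 1 + S" if r: "1 \<le> r" for r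
  proof -
    have ry: "0 < r * y" using r y by simp
    define e where "e = r * y * p3 (r * y) / p2 (r * y)"
    have e: "0 \<le> e" "e \<le> S"
      using p3_nonneg[OF ry] p3_le[OF ry] p2_pos[OF ry] ry by (auto simp: e_def pos_divide_le_eq)
    have "slope y r * (1 + e) \<le> 1 * (1 + S)"
      by (rule mult_mono) (use slope_bounds[OF y r] e in auto)
    moreover have "0 \<le> slope y r * (1 + e)" using slope_bounds[OF y r] e by simp
    ultimately have "\<bar>1 - slope y r * (1 + e)\<bar> \<le> 1 + S" using S_nonneg by (simp add: abs_le_iff)
    moreover have "\<bar>A' r\<bar> = \<bar>1 - slope y r * (1 + e)\<bar> / r" using r by (simp add: A'_def e_def)
    moreover have "\<dots> \<le> \<bar>1 - slope y r * (1 + e)\<bar> / 1" using r by (intro divide_left_mono) auto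
    ultimately show ?thesis by simp
  qed
  have "norm (slope y a - slope y b) \<le> (1 + S) * norm (a - b)"
    by (rule field_differentiable_bound[of "{1..}" "slope y" A']) (use der bound assms in auto)
  then show ?thesis by simp
qed

lemma slope_one: "slope y 1 = 0"
  by (simp add: slope_def)

text \<open>For fixed q the expression times the positive denominator of \<open>slope y q\<close> is
  a polynomial n in y, so its sign is constant near 0.\<close>

lemma slope_sign:
  assumes "1 \<le> q"
  obtains d where "0 < d" "(\<forall>y. 0 < y \<and> y < d \<longrightarrow> 0 \<le> \<alpha> * slope y q - q)
    \<or> (\<forall>y. 0 < y \<and> y < d \<longrightarrow> \<alpha> * slope y q - q \<le> 0)"
proof -
  define n where "n = smult \<alpha> (pcompose (pderiv p) [:0, q:] - pderiv p)
    - smult (q * q) (pCons 0 (pcompose (pderiv (pderiv p)) [:0, q:]))"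
  have n: "poly n y = (\<alpha> * slope y q - q) * (q * y * p2 (q * y))" and pos: "0 < q * y * p2 (q * y)"
    if "0 < y" for y
  proof -
    have qy: "0 < q * y" using assms that by simp
    then show pos: "0 < q * y * p2 (q * y)" using p2_pos[OF qy] by simp
    have "poly n y = \<alpha> * (p1 (q * y) - p1 y) - q * (q * y * p2 (q * y))"
      by (simp add: n_def poly_pcompose algebra_simps)
    also have "p1 (q * y) - p1 y = slope y q * (q * y * p2 (q * y))"
      unfolding slope_def by (rule nonzero_divide_eq_eq[THEN iffD1, OF less_imp_neq[OF pos, symmetric] refl])
    finally show "poly n y = (\<alpha> * slope y q - q) * (q * y * p2 (q * y))" by (simp add: algebra_simps)
  qed
  obtain d where d: "0 < d" "(\<forall>y. 0 < y \<and> y < d \<longrightarrow> 0 \<le> poly n y) \<or> (\<forall>y. 0 < y \<and> y < d \<longrightarrow> poly n y \<le> 0)"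
    by (rule poly_eventually_sign)
  have "0 \<le> poly n y \<longleftrightarrow> 0 \<le> \<alpha> * slope y q - q" "poly n y \<le> 0 \<longleftrightarrow> \<alpha> * slope y q - q \<le> 0" if "0 < y" for y
    using pos[OF that] unfolding n[OF that] zero_le_mult_iff[of _ "q * y * p2 (q * y)"]
      mult_le_0_iff[of _ "q * y * p2 (q * y)"] by linarith+
  then have "(\<forall>y. 0 < y \<and> y < d \<longrightarrow> 0 \<le> \<alpha> * slope y q - q)
    \<or> (\<forall>y. 0 < y \<and> y < d \<longrightarrow> \<alpha> * slope y q - q \<le> 0)"
    using d(2) by (elim disjE) auto
  then show ?thesis using that d(1) by blast
qed

text \<open>The solution through the point lies below the subsolution \<open>\<phi>\<close> to the left of \<open>y0\<close>, hence vanishes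
  at \<open>0\<close>, and above it to the right, hence stays above the diagonal. It has a right derivative at \<open>0\<close>
  because \<open>\<psi> y / y\<close> cannot oscillate: by \<open>slope_sign\<close> it crosses each level in one direction only.\<close>
lemma design_through_point:
  assumes "0 \<le> \<alpha>" and \<phi>0: "\<phi> 0 = 0"
    and \<phi>_ge: "\<And>y. 0 \<le> y \<Longrightarrow> y \<le> \<phi> y"
    and \<phi>_der: "\<And>y. 0 \<le> y \<Longrightarrow> (\<phi> has_real_derivative \<phi>' y) (at y within {0..})"
    and ineq: "\<And>y. 0 < y \<Longrightarrow> \<phi>' y \<le> \<alpha> * ((p1 (\<phi> y) - p1 y) / (\<phi> y * p2 (\<phi> y)))"
    and "0 < y0"
  obtains \<psi> where "\<psi> \<in> design_space \<alpha> (poly p)" "\<psi> y0 = \<phi> y0"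
proof -
  \<comment> \<open>\<open>max r 1\<close> extends the field to all real r with a global Lipschitz
    constant; by \<open>r_ge1\<close> the trajectory stays where the extension agrees with the
    design equation.\<close>
  define F where "F s r = \<alpha> * slope (exp s) (max r 1) - r" for s r
  define K where "K = \<alpha> * (1 + S) + 1"
  have "0 \<le> K" using \<open>0 \<le> \<alpha>\<close> S_nonneg by (simp add: K_def)
  have F_cont: "continuous_on UNIV (\<lambda>z. F (fst z) (snd z))"
  proof -
    have "max b 1 * exp a * p2 (max b 1 * exp a) \<noteq> 0" for a b :: real
      using p2_pos[of "max b 1 * exp a"] by (simp add: less_max_iff_disj)
    then show ?thesis unfolding F_def slope_def by (intro continuous_intros) auto
  qed
  have F_lip: "\<bar>F s a - F s b\<bar> \<le> K * \<bar>a - b\<bar>" for s a b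
  proof -
    have "\<bar>slope (exp s) (max a 1) - slope (exp s) (max b 1)\<bar> \<le> (1 + S) * \<bar>max a 1 - max b 1\<bar>"
      by (rule slope_lipschitz) auto
    also have "\<dots> \<le> (1 + S) * \<bar>a - b\<bar>" using S_nonneg by (intro mult_left_mono) auto
    finally have "\<alpha> * \<bar>slope (exp s) (max a 1) - slope (exp s) (max b 1)\<bar> \<le> \<alpha> * ((1 + S) * \<bar>a - b\<bar>)"
      using \<open>0 \<le> \<alpha>\<close> by (rule mult_left_mono)
    moreover have "\<bar>F s a - F s b\<bar> \<le> \<alpha> * \<bar>slope (exp s) (max a 1) - slope (exp s) (max b 1)\<bar> + \<bar>a - b\<bar>"
    proof -
      have "F s a - F s b = \<alpha> * (slope (exp s) (max a 1) - slope (exp s) (max b 1)) - (a - b)"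
        by (simp add: F_def algebra_simps)
      then show ?thesis using \<open>0 \<le> \<alpha>\<close> abs_triangle_ineq4[of "\<alpha> * (slope (exp s) (max a 1) - slope (exp s) (max b 1))" "a - b"]
        by (simp add: abs_mult)
    qed
    ultimately show ?thesis by (simp add: K_def algebra_simps)
  qed
  have F_bd: "\<bar>F s 0\<bar> \<le> 0" for s by (simp add: F_def slope_one)
  define s0 where "s0 = ln y0"
  define rh where "rh s = \<phi> (exp s) / exp s" for s
  obtain r where r0: "r s0 = rh s0" and r: "\<And>s. (r has_real_derivative F s (r s)) (at s)"
    using picard_global[OF F_cont \<open>0 \<le> K\<close> F_lip F_bd, of s0 "rh s0"] by blast
  have rh_ge1: "1 \<le> rh s" for s using \<phi>_ge[of "exp s"] by (simp add: rh_def pos_le_divide_eq)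
  define rh' where "rh' s = \<phi>' (exp s) - rh s" for s
  have rh: "(rh has_real_derivative rh' s) (at s)" for s
  proof -
    have "at (exp s) within {0..} = at (exp s)"
      by (intro at_within_interior) (auto simp: interior_Ici[of "-1"])
    then have "(\<phi> has_real_derivative \<phi>' (exp s)) (at (exp s))" using \<phi>_der[of "exp s"] by simp
    then have "((\<lambda>s. \<phi> (exp s)) has_real_derivative \<phi>' (exp s) * exp s) (at s)"
      by (rule DERIV_chain2) (rule DERIV_exp)
    then have "(rh has_real_derivative (\<phi>' (exp s) * exp s * exp s - \<phi> (exp s) * exp s) / (exp s * exp s)) (at s)"
      unfolding rh_def[abs_def] by (intro DERIV_divide DERIV_exp) auto
    also have "(\<phi>' (exp s) * exp s * exp s - \<phi> (exp s) * exp s) / (exp s * exp s) = rh' s"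
      by (simp add: rh'_def rh_def field_simps)
    finally show ?thesis .
  qed
  have rh'_le: "rh' s \<le> F s (rh s)" for s
  proof -
    have "rh s * exp s = \<phi> (exp s)" by (simp add: rh_def)
    then have "slope (exp s) (max (rh s) 1) = (p1 (\<phi> (exp s)) - p1 (exp s)) / (\<phi> (exp s) * p2 (\<phi> (exp s)))"
      using rh_ge1[of s] by (simp add: slope_def max_absorb1)
    then show ?thesis using ineq[of "exp s"] by (simp add: rh'_def F_def)
  qed
  have D: "((\<lambda>s. rh s - r s) has_real_derivative rh' s - F s (r s)) (at s)" for s
    by (intro DERIV_diff rh r)
  have D_le: "rh' s - F s (r s) \<le> K * \<bar>rh s - r s\<bar>" for s
    using rh'_le[of s] F_lip[of s "rh s" "r s"] by linarith
  \<comment> \<open>Otherwise the strict order would persist up to s0, where the two trajectories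
    meet.\<close>
  have left: "r s \<le> rh s" if "s \<le> s0" for s
  proof (rule ccontr)
    assume "\<not> r s \<le> rh s"
    then have "rh s0 - r s0 < 0"
      by (intro comparison_neg[OF that \<open>0 \<le> K\<close> D D_le]) auto
    then show False using r0 by simp
  qed
  have right: "rh s \<le> r s" if "s0 \<le> s" for s
    using comparison_nonpos[OF that D D_le] r0 by simp
  have r_ge1: "1 \<le> r s" for s
  proof (cases "s0 \<le> s")
    case True
    then show ?thesis using right[of s] rh_ge1[of s] by simp
  next
    case False
    show ?thesis
    proof (rule ccontr)
      assume "\<not> 1 \<le> r s"
      have "r s0 - 1 < 0"
      proof (rule comparison_neg[of s s0 K "\<lambda>s. r s - 1" "\<lambda>s. F s (r s)"])
        fix t
        \<comment> \<open>The field points downwards at level 1, so a trajectory below it could not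
          climb back by time s0.\<close>
        have "F t 1 = -1" by (simp add: F_def slope_one)
        then show "F t (r t) \<le> K * \<bar>r t - 1\<bar>" using F_lip[of t "r t" 1] by linarith
      qed (use False \<open>\<not> 1 \<le> r s\<close> \<open>0 \<le> K\<close> in \<open>auto intro!: derivative_eq_intros r\<close>)
      then show False using r0 rh_ge1[of s0] by simp
    qed
  qed
  \<comment> \<open>Near the origin r lies between 1 and rh, and rh tends to \<phi>' 0 because
    \<phi> has a right derivative there.\<close>
  have "\<forall>\<^sub>F s in at_bot. 1 \<le> r s \<and> r s \<le> \<phi>' 0 + 1"
  proof -
    have "((\<lambda>y. \<phi> y / y) \<longlongrightarrow> \<phi>' 0) (at_right 0)"
      using \<phi>_der[of 0] by (simp add: has_field_derivative_iff \<phi>0 at_within_Ici_at_right)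
    moreover have "filterlim exp (at_right (0::real)) at_bot"
      by (simp add: filterlim_at exp_at_bot)
    ultimately have "(rh \<longlongrightarrow> \<phi>' 0) at_bot"
      unfolding rh_def[abs_def] by (rule filterlim_compose)
    then have "\<forall>\<^sub>F s in at_bot. rh s < \<phi>' 0 + 1" by (rule order_tendstoD) simp
    moreover have "\<forall>\<^sub>F s in at_bot. s \<le> s0" by (rule eventually_le_at_bot)
    ultimately show ?thesis
    proof eventually_elim
      case (elim s)
      then show ?case using left[of s] r_ge1[of s] by simp
    qed
  qed
  \<comment> \<open>For s < ln d the field has one sign at level q, so q can be crossed in one
    direction only: if r lies beyond q in that direction at arbitrarily early times, it does so at
    every s < ln d.\<close>
  moreover have "(\<forall>\<^sub>F s in at_bot. q \<le> r s) \<or> (\<forall>\<^sub>F s in at_bot. r s \<le> q)" if q: "1 < q" for q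
  proof -
    obtain d where d: "0 < d" "(\<forall>y. 0 < y \<and> y < d \<longrightarrow> 0 \<le> \<alpha> * slope y q - q)
        \<or> (\<forall>y. 0 < y \<and> y < d \<longrightarrow> \<alpha> * slope y q - q \<le> 0)"
      using slope_sign[of q \<alpha>] q by auto
    have F_q: "F s q = \<alpha> * slope (exp s) q - q" for s using q by (simp add: F_def)
    have ex: "exp s < d" if "s < ln d" for s using that d(1) by (metis exp_less_mono exp_ln)
    have small: "\<forall>\<^sub>F s in at_bot. s < ln d" by (rule eventually_gt_at_bot)
    from d(2) show ?thesis
    proof
      assume "\<forall>y. 0 < y \<and> y < d \<longrightarrow> 0 \<le> \<alpha> * slope y q - q"
      then have sign: "0 \<le> F s q" if "s < ln d" for s using ex[OF that] by (simp add: F_q)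
      show ?thesis
      proof (rule disjCI)
        assume "\<not> (\<forall>\<^sub>F s in at_bot. r s \<le> q)"
        then have freq: "\<exists>t\<le>s. q < r t" for s
          by (auto simp: eventually_at_bot_linorder not_le)
        have "q \<le> r s" if s: "s < ln d" for s
        proof -
          obtain t where t: "t \<le> s" "q < r t" using freq by blast
          have "q - r s \<le> 0"
          proof (rule comparison_nonpos[OF t(1), where D = "\<lambda>s. q - r s" and D' = "\<lambda>s. 0 - F s (r s)" and K = K])
            fix x assume "t \<le> x" "x \<le> s"
            show "((\<lambda>s. q - r s) has_real_derivative 0 - F x (r x)) (at x)"
              by (intro DERIV_diff DERIV_const r)
            show "0 - F x (r x) \<le> K * \<bar>q - r x\<bar>"
              using sign[of x] F_lip[of x q "r x"] \<open>x \<le> s\<close> s by linarith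
          qed (use t in auto)
          then show ?thesis by simp
        qed
        then show "\<forall>\<^sub>F s in at_bot. q \<le> r s" by (rule eventually_mono[OF small])
      qed
    next
      assume "\<forall>y. 0 < y \<and> y < d \<longrightarrow> \<alpha> * slope y q - q \<le> 0"
      then have sign: "F s q \<le> 0" if "s < ln d" for s using ex[OF that] by (simp add: F_q)
      show ?thesis
      proof (subst disj_commute, rule disjCI)
        assume "\<not> (\<forall>\<^sub>F s in at_bot. q \<le> r s)"
        then have freq: "\<exists>t\<le>s. r t < q" for s
          by (auto simp: eventually_at_bot_linorder not_le)
        have "r s \<le> q" if s: "s < ln d" for s
        proof -
          obtain t where t: "t \<le> s" "r t < q" using freq by blast
          have "r s - q \<le> 0"
          proof (rule comparison_nonpos[OF t(1), where D = "\<lambda>s. r s - q" and D' = "\<lambda>s. F s (r s) - 0" and K = K])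
            fix x assume "t \<le> x" "x \<le> s"
            show "((\<lambda>s. r s - q) has_real_derivative F x (r x) - 0) (at x)"
              by (intro DERIV_diff DERIV_const r)
            show "F x (r x) - 0 \<le> K * \<bar>r x - q\<bar>"
              using sign[of x] F_lip[of x "r x" q] \<open>x \<le> s\<close> s by linarith
          qed (use t in auto)
          then show ?thesis by simp
        qed
        then show "\<forall>\<^sub>F s in at_bot. r s \<le> q" by (rule eventually_mono[OF small])
      qed
    qed
  qed
  ultimately obtain l where l: "1 \<le> l" "(r \<longlongrightarrow> l) at_bot"
    by (rule convergent_at_bot_if_no_crossing)
  define \<psi> where "\<psi> y = (if y \<le> 0 then 0 else y * r (ln y))" for y
  have \<psi>_ge: "y \<le> \<psi> y" if "0 \<le> y" for y
    using mult_left_mono[OF r_ge1[of "ln y"] that] that by (auto simp: \<psi>_def)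
  have \<psi>_der: "(\<psi> has_real_derivative \<alpha> * ((p1 (\<psi> y) - p1 y) / (\<psi> y * p2 (\<psi> y)))) (at y within {0..})"
    if y: "0 < y" for y
  proof -
    have "((\<lambda>y. r (ln y)) has_real_derivative F (ln y) (r (ln y)) * (1 / y)) (at y)"
      by (rule DERIV_chain2[OF r DERIV_ln_divide[OF y]])
    then have "((\<lambda>y. y * r (ln y)) has_real_derivative 1 * r (ln y) + F (ln y) (r (ln y)) * (1 / y) * y) (at y)"
      by (intro DERIV_mult DERIV_ident)
    also have "1 * r (ln y) + F (ln y) (r (ln y)) * (1 / y) * y = \<alpha> * slope y (r (ln y))"
      using y r_ge1[of "ln y"] by (simp add: F_def max_absorb1)
    also have "slope y (r (ln y)) = (p1 (\<psi> y) - p1 y) / (\<psi> y * p2 (\<psi> y))"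
      using y by (simp add: slope_def \<psi>_def mult.commute)
    finally have "((\<lambda>y. y * r (ln y)) has_real_derivative \<alpha> * ((p1 (\<psi> y) - p1 y) / (\<psi> y * p2 (\<psi> y)))) (at y within {0..})"
      by (rule DERIV_subset) simp
    then show ?thesis
      by (rule has_field_derivative_transform_within[OF _ y]) (use y in \<open>auto simp: \<psi>_def dist_real_def\<close>)
  qed
  have \<psi>_der0: "(\<psi> has_real_derivative l) (at 0 within {0..})"
  proof -
    have "((\<lambda>y. r (ln y)) \<longlongrightarrow> l) (at_right 0)"
      by (rule filterlim_compose[OF l(2) ln_at_0])
    moreover have "\<forall>\<^sub>F y in at_right 0. r (ln y) = (\<psi> y - \<psi> 0) / (y - 0)"
      by (rule eventually_mono[OF eventually_at_right_less[of 0]]) (simp add: \<psi>_def)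
    ultimately have "((\<lambda>y. (\<psi> y - \<psi> 0) / (y - 0)) \<longlongrightarrow> l) (at_right 0)"
      by (rule Lim_transform_eventually)
    moreover have "at_right (0::real) = at 0 within {0..}"
      using at_within_Ici_at_right[of "0::real"] by simp
    ultimately show ?thesis by (simp add: has_field_derivative_iff)
  qed
  have "\<psi> \<in> design_space \<alpha> (poly p)"
    unfolding design_space_def
  proof (intro CollectI conjI allI impI)
    show "\<psi> 0 = 0" by (simp add: \<psi>_def)
    fix y :: real assume y: "0 \<le> y"
    show "y \<le> \<psi> y" by (rule \<psi>_ge[OF y])
    have "\<exists>d\<ge>0. (\<psi> has_real_derivative d) (at y within {0..})"
    proof (cases "y = 0")
      case True
      then show ?thesis using \<psi>_der0 l by (intro exI[of _ l]) auto
    next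
      case False
      then have y': "0 < y" "0 < \<psi> y" using y \<psi>_ge[of y] by auto
      have "0 \<le> \<alpha> * ((p1 (\<psi> y) - p1 y) / (\<psi> y * p2 (\<psi> y)))"
        using p1_mono[OF y \<psi>_ge[OF y]] p2_pos[OF y'(2)] y' \<open>0 \<le> \<alpha>\<close> by simp
      then show ?thesis using \<psi>_der[OF y'(1)] by blast
    qed
    then obtain d where d: "0 \<le> d" "(\<psi> has_real_derivative d) (at y within {0..})" by blast
    show "\<psi> differentiable at y within {0..}"
      using d(2) by (auto simp: real_differentiable_def)
    show "0 \<le> cost_deriv \<psi> y" using cost_deriv_eqI[OF d(2) y] d(1) by simp
  next
    fix y :: real assume y: "0 < y"
    have "0 \<le> \<psi> y" using \<psi>_ge[of y] y by simp
    then show "cost_deriv \<psi> y = \<alpha> * ((cost_deriv (poly p) (\<psi> y) - cost_deriv (poly p) y) /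
        (\<psi> y * cost_deriv (cost_deriv (poly p)) (\<psi> y)))"
      using cost_deriv_eqI[OF \<psi>_der[OF y]] y by (simp add: cost_deriv_p cost_deriv2_p)
  qed
  moreover have "\<psi> y0 = \<phi> y0"
    using \<open>0 < y0\<close> r0 by (simp add: \<psi>_def s0_def rh_def)
  ultimately show ?thesis by (rule that)
qed

end

section \<open>Universality\<close>

lemma regular_poly_cost:
  assumes "1 \<le> \<tau>" "\<tau> \<le> \<sigma>" "1 < \<sigma>" and c: "poly_coeffs \<tau> \<sigma> c"
  shows "regular_poly (cost_poly \<tau> \<sigma> c) (real \<sigma> - 2)"
proof -
  interpret cost_bounds \<tau> \<sigma> using assms by unfold_locales
  let ?p = "cost_poly \<tau> \<sigma> c"
  show ?thesis
  proof
    show "poly ?p 0 = 0" using assms(1) by (simp add: poly_0_coeff_0 coeff_cost_poly)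
    fix y :: real assume y: "0 < y"
    show p2: "0 < poly (pderiv (pderiv ?p)) y"
      using pderiv2_pos[OF c y] by (simp add: pderiv2_eq)
    have p3: "y * poly (pderiv (pderiv (pderiv ?p))) y = elast2 \<tau> \<sigma> c y * poly (pderiv (pderiv ?p)) y"
      using pderiv3_elast2[OF c y] by (simp add: pderiv2_eq pderiv3_eq)
    have "0 \<le> y * poly (pderiv (pderiv (pderiv ?p))) y"
      unfolding p3 using elast2_bounds(1)[OF c y] p2 by simp
    then show "0 \<le> poly (pderiv (pderiv (pderiv ?p))) y" using y by (simp add: zero_le_mult_iff)
    show "y * poly (pderiv (pderiv (pderiv ?p))) y \<le> (real \<sigma> - 2) * poly (pderiv (pderiv ?p)) y"
      unfolding p3 using elast2_bounds(3)[OF c y] p2 by (intro mult_right_mono) auto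
  qed
qed

lemma (in coeff_bounds) safe_envelope_universal:
  assumes env: "safe_envelope J g fhat" and "1 \<le> \<alpha>"
  shows "universal_design_space m \<alpha> fhat (poly_class \<tau> \<sigma> lo hi)"
proof -
  have main: "(\<forall>y0>0. \<exists>\<psi>\<in>design_space \<alpha> f. \<psi> y0 = \<phi> y0) \<and> competitive_design m \<alpha> f \<phi>"
    if f: "f \<in> poly_class \<tau> \<sigma> lo hi" and \<phi>: "\<phi> \<in> design_space \<alpha> fhat" for f \<phi>
  proof -
    obtain c where c: "poly_coeffs \<tau> \<sigma> c" "\<forall>k\<in>{\<tau>..\<sigma>}. lo k \<le> c k \<and> c k \<le> hi k"
      and fc: "f = poly_cost \<tau> \<sigma> c"
      using f unfolding poly_class_def by blast
    define p where "p = cost_poly \<tau> \<sigma> c"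
    have fp: "f = poly p" by (simp add: fc p_def poly_cost_poly fun_eq_iff)
    interpret regular_poly p "real \<sigma> - 2"
      unfolding p_def by (rule regular_poly_cost[OF tau sigma c(1)])
    have \<phi>0: "\<phi> 0 = 0" and \<phi>_ge: "\<And>y. 0 \<le> y \<Longrightarrow> y \<le> \<phi> y"
      and \<phi>_nonneg: "\<And>y. 0 \<le> y \<Longrightarrow> 0 \<le> cost_deriv \<phi> y"
      and \<phi>_diff: "\<And>y. 0 \<le> y \<Longrightarrow> \<phi> differentiable (at y within {0..})"
      and ode: "\<And>y. 0 < y \<Longrightarrow> cost_deriv \<phi> y = \<alpha> * ((cost_deriv fhat (\<phi> y) - cost_deriv fhat y) /
                 (\<phi> y * cost_deriv (cost_deriv fhat) (\<phi> y)))"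
      using \<phi> unfolding design_space_def by auto
    have \<phi>_der: "(\<phi> has_real_derivative cost_deriv \<phi> y) (at y within {0..})" if "0 \<le> y" for y
      using \<phi>_diff[OF that] cost_deriv_eqI[OF _ that, of \<phi>] by (auto simp: real_differentiable_def)
    have sub: "cost_deriv \<phi> y \<le> \<alpha> * ((p1 (\<phi> y) - p1 y) / (\<phi> y * p2 (\<phi> y)))" if y: "0 < y" for y
      unfolding ode[OF y] p_def
      using safe_envelope_slope_le[OF env c y] \<phi>_ge[of y] y \<open>1 \<le> \<alpha>\<close> by (intro mult_left_mono) auto
    have "\<exists>\<psi>\<in>design_space \<alpha> (poly p). \<psi> y0 = \<phi> y0" if y0: "0 < y0" for y0
    proof -
      have "0 \<le> \<alpha>" using \<open>1 \<le> \<alpha>\<close> by simp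
      obtain \<psi> where "\<psi> \<in> design_space \<alpha> (poly p)" "\<psi> y0 = \<phi> y0"
        by (rule design_through_point[OF \<open>0 \<le> \<alpha>\<close> \<phi>0 \<phi>_ge \<phi>_der sub y0])
      then show ?thesis by blast
    qed
    moreover have "competitive_design m \<alpha> (poly p) \<phi>"
    proof (rule competitive_design_of_diff_ineq[OF \<open>1 \<le> \<alpha>\<close> \<phi>0 \<phi>_ge \<phi>_der \<phi>_nonneg])
      fix y :: real assume y: "0 < y"
      then have "0 < \<phi> y" using \<phi>_ge[of y] by simp
      then have "0 < \<phi> y * p2 (\<phi> y)" using p2_pos by simp
      then show "cost_deriv \<phi> y * (\<phi> y * p2 (\<phi> y)) \<le> \<alpha> * (p1 (\<phi> y) - p1 y)"
        using sub[OF y] by (simp add: pos_le_divide_eq)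
    qed
    ultimately show ?thesis by (simp add: fp)
  qed
  have "design_region \<alpha> fhat \<subseteq> design_region \<alpha> f" if f: "f \<in> poly_class \<tau> \<sigma> lo hi" for f
  proof
    fix P assume "P \<in> design_region \<alpha> fhat"
    then obtain \<phi> y where \<phi>: "\<phi> \<in> design_space \<alpha> fhat" and P: "P = (y, \<phi> y)" "0 \<le> y"
      unfolding design_region_def by blast
    have "\<exists>\<psi>\<in>design_space \<alpha> f. \<psi> y = \<phi> y"
    proof (cases "y = 0")
      case True
      \<comment> \<open>\<open>main\<close> supplies designs through points with positive abscissa;
        the one at abscissa 1 also passes through the origin.\<close>
      obtain \<psi> where \<psi>: "\<psi> \<in> design_space \<alpha> f" using main[OF f \<phi>] zero_less_one by blast
      have "\<psi> 0 = 0" "\<phi> 0 = 0" using \<psi> \<phi> by (simp_all add: design_space_def)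
      with \<psi> True show ?thesis by auto
    next
      case False
      then show ?thesis using main[OF f \<phi>] P(2) by simp
    qed
    then obtain \<psi> where \<psi>: "\<psi> \<in> design_space \<alpha> f" "P = (y, \<psi> y)" using P(1) by auto
    then show "P \<in> design_region \<alpha> f"
      unfolding design_region_def using P(2) by (intro UN_I[OF \<psi>(1)]) auto
  qed
  then show ?thesis unfolding universal_design_space_def using main by blast
qed

text \<open>The envelope enters as a predicate because its values at negative arguments are left
  open; existence is therefore stated next to the properties of every such function. For \<tau> =
  \<sigma> the family is empty and no envelope exists. For \<tau> = 1 the envelope has slope
  \<open>lo 1 > 0\<close> at 0, so the normalization f' 0 = 0 is claimed only for \<tau> >
  1.\<close>

theorem theorem4:
  fixes m \<tau> \<sigma> :: nat and lo hi :: "nat \<Rightarrow> real"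
  assumes "m \<ge> 1" and "1 \<le> \<tau>" and "\<tau> \<le> \<sigma>" and "1 < \<sigma>"
    and "\<forall>k\<in>{\<tau>..\<sigma>}. 0 \<le> lo k \<and> lo k \<le> hi k"
    and "lo \<tau> > 0" and "lo \<sigma> > 0"
  shows "(\<tau> < \<sigma> \<longrightarrow> (\<exists>fhat. safe_envelope {\<tau>..<\<sigma>} (threshold_cost \<tau> \<sigma> lo hi) fhat)) \<and>
    (\<forall>fhat. safe_envelope {\<tau>..<\<sigma>} (threshold_cost \<tau> \<sigma> lo hi) fhat \<longrightarrow>
       (1 < \<tau> \<longrightarrow> strongly_elastic (real \<tau>) (real \<sigma>) fhat) \<and>
       (\<tau> = 1 \<longrightarrow> elastic_up_to_slope (real \<tau>) (real \<sigma>) fhat \<and>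
                  second_elasticity_bounds (real \<tau>) (real \<sigma>) fhat) \<and>
       (\<forall>\<alpha>. \<alpha> \<ge> real \<sigma> powr (real \<sigma> / (real \<sigma> - 1)) \<longrightarrow>
          universal_design_space m \<alpha> fhat (poly_class \<tau> \<sigma> lo hi)))"
proof (cases "\<tau> < \<sigma>")
  case True
  interpret coeff_bounds \<tau> \<sigma> lo hi using assms True by unfold_locales
  have \<alpha>: "1 \<le> \<alpha>" if "\<alpha> \<ge> real \<sigma> powr (real \<sigma> / (real \<sigma> - 1))" for \<alpha>
    using ge_one_powr_ge_zero[of "real \<sigma>" "real \<sigma> / (real \<sigma> - 1)"] \<open>1 < \<sigma>\<close> that by simp
  show ?thesis
    using safe_envelope_exists safe_envelope_elastic safe_envelope_universal \<alpha>
    unfolding strongly_elastic_def elastic_def by blast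
next
  case False
  then show ?thesis by (simp add: safe_envelope_def)
qed

end
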